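(* There exist absolute constants $c_1,c_2,c_3>0$ such that for all integers $b,g,m,n,k$ with $b\ge n>m\ge 1$, $1\le g\le n$, $1\le k\le 2^n$, and all real $\epsilon$ with $0<\epsilon\le 2$, $$\ln\Big(\mu_{\Delta(2^m)^k}\big(X(b,g,m,n;2^m,2/e-\epsilon,k)\big)\Big)\le 2^{c_1 g}\,b\ln(2b/\epsilon)+c_2mk-c_3\epsilon^2 2^m k,$$ where $\ln 0=-\infty$.
   Context: Probability simplices. $\Delta(N)=\{\mathbf x\in\mathbb R^N: x_i\ge 0 \text{ for all } i,\ \sum_i x_i=1\}$. For a subset $S\subseteq\{1,\dots,N\}$ let $\Delta(S,N)$ be the face $\{\mathbf x\in\Delta(N): x_i=0 \text{ for } i\notin S\}$, and $\Delta(N',N)=\bigcup_{|S|=N'}\Delta(S,N)$, so $\Delta(N,N)=\Delta(N)$. $\Delta(N',N)^k$ is the set of $k$-tuples of members of $\Delta(N',N)$; $\mu_{\Delta(N',N)^k}$ is the uniform probability measure on it, i.e. the Lebesgue measure of the appropriate dimension normalized to total mass 1 (equivalently the $k$-fold product of the measure that chooses $S$ with $|S|=N'$ uniformly and then a uniformly distributed point of $\Delta(S,N)$). For $\mathbf x,\mathbf y\in\Delta(N)$ the total variation distance (TVD) is $|\mathbf x-\mathbf y|_1=\sum_i|x_i-y_i|$; for $k$-tuples $\mathbf x=(\mathbf x_1,\dots,\mathbf x_k),\mathbf y=(\mathbf y_1,\dots,\mathbf y_k)\in\Delta(N)^k$ it is the average $|\mathbf x-\mathbf y|_1=\frac1k\sum_{i=1}^k|\mathbf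 x_i-\mathbf y_i|_1$. Quantum circuits. $H_n=(\mathbb C^2)^{\otimes n}$ with standard orthonormal basis $|b_1b_2\dots b_n\rangle$, $b_i\in\{0,1\}$; for $0\le j<2^n$, $|j\rangle$ denotes the basis vector given by the binary digits of $j$ in reverse order ($j=\sum_i b_i2^{i-1}$). A $g$-input quantum gate is a unitary operator $V$ on $H_g$; applied to a choice of $g$ of the $n$ qubits it acts on $H_n\cong H_g\otimes H_{n-g}$ as $V\otimes I$, the factor $H_g$ corresponding to the chosen qubits. $G_g^{(b,n)}$ is the set of unitary operators on $H_n$ expressible as a composition of at most $b$ $g$-input gates (each with its own choice of $g$ qubits). For a unit vector $|x\rangle\in H_n$ and $m\le n$, $\mathrm{Prob}_m(\cdot\mid|x\rangle)\in\Delta(2^m)$ is the distribution on $m$-bit vectors $c$ given by $\mathrm{Prob}_m(c\mid|x\rangle)=\sum_{c'\in\{0,1\}^{n-m}}|\langle cc'|x\rangle|^2$. For $U$ unitary on $H_n$, $\phi_m(U)\in\Delta(2^m)^k$ is the $k$-tuple $(\mathrm{Prob}_m(\cdot\mid U|0\rangle),\dots,\mathrm{Prob}_m(\cdot\mid U|k-1\rangle))$. $X(b,g,m,n;N,d,k)$ is the set of members of $\Delta(N,2^m)^k$ which are within average TVD $d$ of some element of $\phi_m(G_g^{(b,n)})$. *)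

theory Defs
  imports
    "HOL-Probability.Probability"
    "Jordan_Normal_Form.Schur_Decomposition"
begin

unbundle no vec_syntax

section \<open>Probability simplices\<close>

text \<open>Points of \<open>\<real>\<^sup>N\<close> are extensional functions on \<open>{..<N}\<close>, as in the library's finite
  product measures; coordinates are numbered from \<open>0\<close>.\<close>

definition prob_simplex :: "nat \<Rightarrow> (nat \<Rightarrow> real) set" where
  "prob_simplex N = {x \<in> extensional {..<N}. (\<forall>i<N. 0 \<le> x i) \<and> (\<Sum>i<N. x i) = 1}"

definition simplex_face :: "nat set \<Rightarrow> nat \<Rightarrow> (nat \<Rightarrow> real) set" where
  "simplex_face S N = {x \<in> prob_simplex N. \<forall>i<N. i \<notin> S \<longrightarrow> x i = 0}"

definition simplex_skeleton :: "nat \<Rightarrow> nat \<Rightarrow> (nat \<Rightarrow> real) set" where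
  "simplex_skeleton N' N = (\<Union>S \<in> {S. S \<subseteq> {..<N} \<and> card S = N'}. simplex_face S N)"

text \<open>Dropping the last coordinate is an affine bijection from the simplex in \<open>\<real>\<^sup>N\<close> onto the
  following full-dimensional set in \<open>\<real>\<^sup>N\<^sup>-\<^sup>1\<close>. It multiplies \<open>(N - 1)\<close>-dimensional Lebesgue
  measure by a constant, so the normalized Lebesgue measure on the simplex is the image of the
  uniform measure on this set.\<close>

definition corner_simplex :: "nat \<Rightarrow> (nat \<Rightarrow> real) set" where
  "corner_simplex N =
     {y \<in> extensional {..<N - 1}. (\<forall>i<N - 1. 0 \<le> y i) \<and> (\<Sum>i<N - 1. y i) \<le> 1}"

definition add_last_coord :: "nat \<Rightarrow> (nat \<Rightarrow> real) \<Rightarrow> nat \<Rightarrow> real" where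
  "add_last_coord N y = (\<lambda>i\<in>{..<N}. if i = N - 1 then 1 - (\<Sum>j<N - 1. y j) else y i)"

definition uniform_simplex :: "nat \<Rightarrow> (nat \<Rightarrow> real) measure" where
  "uniform_simplex N =
     distr (uniform_measure (Pi\<^sub>M {..<N - 1} (\<lambda>_. lborel)) (corner_simplex N))
           (Pi\<^sub>M {..<N} (\<lambda>_. borel)) (add_last_coord N)"

definition uniform_simplex_tuples :: "nat \<Rightarrow> nat \<Rightarrow> (nat \<Rightarrow> nat \<Rightarrow> real) measure" where
  "uniform_simplex_tuples N k = Pi\<^sub>M {..<k} (\<lambda>_. uniform_simplex N)"

text \<open>The total variation distance is not halved here.\<close>

definition tvd :: "nat \<Rightarrow> (nat \<Rightarrow> real) \<Rightarrow> (nat \<Rightarrow> real) \<Rightarrow> real" where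
  "tvd N x y = (\<Sum>i<N. \<bar>x i - y i\<bar>)"

definition avg_tvd :: "nat \<Rightarrow> nat \<Rightarrow> (nat \<Rightarrow> nat \<Rightarrow> real) \<Rightarrow> (nat \<Rightarrow> nat \<Rightarrow> real) \<Rightarrow> real" where
  "avg_tvd N k x y = (\<Sum>i<k. tvd N (x i) (y i)) / real k"


section \<open>Quantum circuits\<close>

text \<open>The space \<open>H\<^sub>n\<close> of \<open>n\<close> qubits is \<^term>\<open>carrier_vec (2 ^ n) :: complex vec set\<close>. The basis
  vector \<open>|b\<^sub>1 \<dots> b\<^sub>n\<rangle>\<close> has index \<open>j = \<Sum>\<^sub>i b\<^sub>i 2\<^sup>i\<^sup>-\<^sup>1\<close>, so qubits are numbered from \<open>0\<close> and
  the value of qubit \<open>q\<close> in the basis vector with index \<open>j\<close> is \<^term>\<open>bit j q\<close>.\<close>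

definition ket :: "nat \<Rightarrow> nat \<Rightarrow> complex vec" where
  "ket n j = unit_vec (2 ^ n) j"

definition unitary_mats :: "nat \<Rightarrow> complex mat set" where
  "unitary_mats d = {U \<in> carrier_mat d d.
     inverts_mat U (mat_adjoint U) \<and> inverts_mat (mat_adjoint U) U}"

text \<open>A choice of \<open>g\<close> qubits is an injection \<open>s\<close>: input \<open>q\<close> of the gate is qubit \<open>s q\<close>.
  The basis index of \<open>H\<^sub>g\<close> seen by the gate is read off from the selected qubits. The gate
  acts as \<open>V \<otimes> I\<close>: its matrix entries vanish unless all other qubits agree.\<close>

definition selected_index :: "nat \<Rightarrow> (nat \<Rightarrow> nat) \<Rightarrow> nat \<Rightarrow> nat" where
  "selected_index g s j = (\<Sum>q<g. of_bool (bit j (s q)) * 2 ^ q)"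

definition apply_gate :: "nat \<Rightarrow> nat \<Rightarrow> (nat \<Rightarrow> nat) \<Rightarrow> complex mat \<Rightarrow> complex mat" where
  "apply_gate n g s V = mat (2 ^ n) (2 ^ n) (\<lambda>(i, j).
     if \<forall>q<n. q \<notin> s ` {..<g} \<longrightarrow> bit i q = bit j q
     then V $$ (selected_index g s i, selected_index g s j) else 0)"

definition gates :: "nat \<Rightarrow> nat \<Rightarrow> complex mat set" where
  "gates g n = {apply_gate n g s V | s V.
     s ` {..<g} \<subseteq> {..<n} \<and> inj_on s {..<g} \<and> V \<in> unitary_mats (2 ^ g)}"

definition circuits :: "nat \<Rightarrow> nat \<Rightarrow> nat \<Rightarrow> complex mat set" where
  "circuits b g n = {foldr (*) Us (1\<^sub>m (2 ^ n)) | Us. length Us \<le> b \<and> set Us \<subseteq> gates g n}"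

text \<open>The index of \<open>|c c'\<rangle>\<close>, with \<open>c\<close> of \<open>m\<close> bits, is \<open>c + 2\<^sup>m c'\<close>.\<close>

definition outcome_prob :: "nat \<Rightarrow> nat \<Rightarrow> complex vec \<Rightarrow> nat \<Rightarrow> real" where
  "outcome_prob m n x =
     (\<lambda>c\<in>{..<2 ^ m}. \<Sum>c'<2 ^ (n - m). (cmod (vec_index x (c + 2 ^ m * c')))\<^sup>2)"

definition output_tuple :: "nat \<Rightarrow> nat \<Rightarrow> nat \<Rightarrow> complex mat \<Rightarrow> nat \<Rightarrow> nat \<Rightarrow> real" where
  "output_tuple m n k U = (\<lambda>i\<in>{..<k}. outcome_prob m n (U *\<^sub>v ket n i))"

text \<open>Since \<^term>\<open>circuits b g n\<close> is compact, the following set is closed, hence measurable.\<close>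

definition approximable ::
  "nat \<Rightarrow> nat \<Rightarrow> nat \<Rightarrow> nat \<Rightarrow> nat \<Rightarrow> real \<Rightarrow> nat \<Rightarrow> (nat \<Rightarrow> nat \<Rightarrow> real) set" where
  "approximable b g m n N d k =
     {x \<in> {..<k} \<rightarrow>\<^sub>E simplex_skeleton N (2 ^ m).
        \<exists>y \<in> output_tuple m n k ` circuits b g n. avg_tvd (2 ^ m) k x y \<le> d}"


section \<open>Logarithm with value \<open>-\<infinity>\<close> at \<open>0\<close>\<close>

definition ext_ln :: "real \<Rightarrow> ereal" where
  "ext_ln x = (if x = 0 then -\<infinity> else ereal (ln x))"

end

theory Submission
  imports Defs
begin

text \<open>The uniform density on the simplex in \<open>\<real>\<^sup>N\<close>, written in the first \<open>N - 1\<close> coordinates, is at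
  most \<open>e N\<close> times the density of independent exponential variables of mean \<open>1/N\<close>, because
  \<open>(N - 1)! e\<^sup>N \<le> e N\<^sup>N\<close>; over \<open>k\<close> tuples this loss is absorbed by the term in \<open>m k\<close>. For
  exponential variables the Laplace transform of the distance to a fixed point factorizes, and
  Chernoff's bound shows that a fixed tuple is within \<open>2/e - \<epsilon>/2\<close> of a random one with
  probability at most \<open>exp (O(m k) - c \<epsilon>\<^sup>2 2\<^sup>m k)\<close>. The missing last coordinate is recovered from
  \<open>\<bar>x\<^sub>N - y\<^sub>N\<bar> \<ge> \<alpha> \<Sum> (x\<^sub>j - y\<^sub>j)\<close>, the sum being over the other coordinates, for
  \<open>0 \<le> \<alpha> \<le> 1\<close>. A union bound over a net of circuits concludes: rounding the gate entries to a
  grid of mesh of order \<open>\<epsilon> / (b 2\<^sup>g)\<close> moves the outputs by at most \<open>\<epsilon>/2\<close>, since gates are isometric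
  and errors therefore add up.\<close>

section \<open>Concentration on the simplex\<close>

text \<open>Raising \<open>1 - x \<le> exp (- x)\<close> at \<open>x = 1 / (n + 2)\<close> to the
  power \<open>n + 2\<close> gives e (n+1)^(n+2) \<le> (n+2)^(n+2), which is exactly what the
  induction step needs.\<close>

lemma fact_mult_exp_le: "fact n * exp (real n) \<le> real (Suc n) ^ Suc n"
proof (induction n)
  case (Suc n)
  have "exp 1 * real (Suc n) ^ (n + 2) \<le> real (n + 2) ^ (n + 2)"
  proof -
    have "(1 - 1 / real (n + 2)) ^ (n + 2) \<le> exp (- (1 / real (n + 2))) ^ (n + 2)"
      by (intro power_mono) (use exp_ge_add_one_self[of "- (1 / real (n + 2))"] in auto)
    also have "\<dots> = exp (- 1)"
      by (subst exp_of_nat_mult[symmetric]) simp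
    also have "1 - 1 / real (n + 2) = real (Suc n) / real (n + 2)"
      by (simp add: field_simps)
    finally have "real (Suc n) ^ (n + 2) \<le> exp (- 1) * real (n + 2) ^ (n + 2)"
      by (simp add: power_divide divide_simps del: of_nat_Suc of_nat_add power_Suc)
    then show ?thesis
      by (simp add: exp_minus field_simps del: of_nat_Suc of_nat_add power_Suc)
  qed
  moreover have "fact (Suc n) * exp (real (Suc n)) = exp 1 * real (Suc n) * (fact n * exp (real n))"
    by (simp add: exp_add algebra_simps)
  moreover have "\<dots> \<le> exp 1 * real (Suc n) * real (Suc n) ^ Suc n"
    by (intro mult_left_mono Suc) auto
  moreover have "\<dots> = exp 1 * real (Suc n) ^ (n + 2)"
    by simp
  ultimately show ?case
    by (simp only: add_2_eq_Suc' )
qed simp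

text \<open>This is the volume of the standard simplex in dimension \<open>N - 1\<close>. Since
  subtraction truncates, \<open>N = 0\<close> and \<open>N = 1\<close> both give a one-point space
  of mass 1, in agreement with \<open>fact 0 = 1\<close>.\<close>

lemma emeasure_corner_simplex:
  "emeasure (Pi\<^sub>M {..<N - 1} (\<lambda>_. lborel)) (corner_simplex N) = ennreal (1 / fact (N - 1))"
proof -
  have eq: "corner_simplex N = {x. (\<forall>i\<in>{..<N - 1}. 0 \<le> x i) \<and> sum x {..<N - 1} \<le> 1} \<inter>
      space (Pi\<^sub>M {..<N - 1} (\<lambda>_. lborel))"
    by (auto simp: corner_simplex_def space_PiM PiE_def)
  have "emeasure (Pi\<^sub>M {..<N - 1} (\<lambda>_. lborel)) (corner_simplex N)
      = ennreal (1 ^ card {..<N - 1} / fact (card {..<N - 1}))"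
    unfolding eq by (rule emeasure_std_simplex_aux) auto
  then show ?thesis
    by simp
qed

lemma measurable_add_last_coord [measurable]:
  "add_last_coord N \<in> Pi\<^sub>M {..<N - 1} (\<lambda>_. lborel) \<rightarrow>\<^sub>M Pi\<^sub>M {..<N} (\<lambda>_. borel)"
  unfolding add_last_coord_def
proof (intro measurable_restrict)
  fix i assume "i \<in> {..<N}"
  then have "i < N - 1" if "i \<noteq> N - 1"
    using that by auto
  then show "(\<lambda>x. if i = N - 1 then 1 - sum x {..<N - 1} else x i)
      \<in> Pi\<^sub>M {..<N - 1} (\<lambda>_. lborel) \<rightarrow>\<^sub>M borel"
    by (cases "i = N - 1") auto
qed

text \<open>Measurability comes for free from the volume: \<open>emeasure\<close> vanishes on every
  non-measurable set.\<close>

lemma corner_simplex_in_sets: "corner_simplex N \<in> sets (Pi\<^sub>M {..<N - 1} (\<lambda>_. lborel))"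
  by (rule emeasure_neq_0_sets) (unfold emeasure_corner_simplex, simp)

lemma sets_uniform_simplex [measurable_cong]:
  "sets (uniform_simplex N) = sets (Pi\<^sub>M {..<N} (\<lambda>_. borel))"
  by (simp add: uniform_simplex_def)

lemma space_uniform_simplex: "space (uniform_simplex N) = extensional {..<N}"
  by (simp add: uniform_simplex_def space_PiM PiE_def)

lemma prob_space_uniform_simplex: "prob_space (uniform_simplex N)"
  unfolding uniform_simplex_def
proof (rule prob_space.prob_space_distr)
  show "prob_space (uniform_measure (Pi\<^sub>M {..<N - 1} (\<lambda>_. lborel)) (corner_simplex N))"
    by (rule prob_space_uniform_measure) (unfold emeasure_corner_simplex, simp_all)
  show "add_last_coord N \<in> uniform_measure (Pi\<^sub>M {..<N - 1} (\<lambda>_. lborel)) (corner_simplex N)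
      \<rightarrow>\<^sub>M Pi\<^sub>M {..<N} (\<lambda>_. borel)"
    using measurable_add_last_coord[of N]
    by (subst measurable_cong_sets[OF sets_uniform_measure refl])
qed

text \<open>For an exponential variable \<open>x\<close> of mean \<open>1\<close>, the expectation of \<open>\<bar>x - t\<bar>\<close> is the convex
  function \<open>t - 1 + 2 e\<^sup>-\<^sup>t\<close>, whose value at \<open>t = 1\<close> is \<open>2/e\<close> and whose slope there is
  \<open>tilt\<close>. Hence the expectation of \<open>\<bar>x - t\<bar> + tilt (x - t)\<close> is at least \<open>2/e\<close> for every \<open>t\<close>.\<close>

definition tilt :: real where "tilt = 1 - 2 / exp 1"

lemma tilt_bounds: "0 \<le> tilt" "tilt \<le> 1"
  using exp_ge_add_one_self[of 1] by (auto simp: tilt_def field_simps)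

section \<open>The Laplace transform of the tilted distance in one coordinate\<close>

text \<open>The left side is the expectation of exp (-\<theta> (|x - t| + tilt (x - t))) for an
  exponential variable x of mean 1, split at \<open>t\<close>; \<open>a\<close> and \<open>c\<close>
  are the rates of decay away from \<open>t\<close> on the left and on the right. To first order in
  \<theta> it is 1 minus \<theta> times a mean of at least 2/e, and the quadratic term absorbs the
  remainder uniformly in \<open>t\<close>.\<close>

lemma tilted_laplace_closed_form_le:
  fixes t \<theta> :: real
  assumes "0 \<le> t" "0 \<le> \<theta>" "\<theta> \<le> 1 / 8"
  defines "a \<equiv> \<theta> * (1 - tilt)" and "c \<equiv> \<theta> * (1 + tilt)"
  shows "(exp (- (a * t)) - exp (- t)) / (1 - a) + exp (- t) / (1 + c)
    \<le> exp (- (2 * \<theta> / exp 1) + 4 * \<theta>\<^sup>2)"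
proof -
  define w :: real where "w = 1 / exp 1"
  have w: "0 < w" "w \<le> 1 / 2"
    using exp_ge_add_one_self[of 1] by (auto simp: w_def field_simps)
  have a: "a = 2 * \<theta> * w" and c: "c = 2 * \<theta> * (1 - w)"
    by (auto simp: a_def c_def tilt_def w_def)
  have a0: "0 \<le> a" "a \<le> 1 / 8"
    using assms(2,3) w mult_mono[of \<theta> "1/8" w "1/2"] by (auto simp: a)
  have c0: "0 \<le> c"
    using assms(2) w by (auto simp: c)
  \<comment> \<open>Factoring out the main exponential leaves \<open>1 - z\<close>. The factors
    \<open>1 / (1 - a)\<close> and \<open>1 - z\<close> are then bounded by exponentials separately,
    so that only exponents remain to be compared.\<close>
  define z where "z = 2 * \<theta> * exp (- ((1 - a) * t)) / (1 + c)"
  have "(exp (- (a * t)) - exp (- t)) / (1 - a) + exp (- t) / (1 + c)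
      = exp (- (a * t)) / (1 - a) * (1 - z)"
  proof -
    define A T where "A = exp (- (a * t))" and "T = exp (- t)"
    have "exp (- ((1 - a) * t)) = T / A"
      by (simp flip: exp_diff add: A_def T_def algebra_simps)
    then have z: "z = (a + c) * (T / A) / (1 + c)"
      by (simp add: z_def a c algebra_simps)
    have "A \<noteq> 0" "1 - a \<noteq> 0" "1 + c \<noteq> 0"
      using a0 c0 by (auto simp: A_def)
    then show ?thesis
      unfolding A_def[symmetric] T_def[symmetric] z by (simp add: divide_simps) (simp add: algebra_simps)
  qed
  also have "\<dots> \<le> (exp (- (a * t)) * exp (a + 2 * a\<^sup>2)) * exp (- z)"
  proof (intro mult_mono)
    have "1 / (1 - a) = 1 + a / (1 - a)"
      using a0 by (simp add: field_simps)
    also have "\<dots> \<le> exp (a / (1 - a))"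
      by (rule exp_ge_add_one_self)
    also have "a / (1 - a) \<le> a + 2 * a\<^sup>2"
    proof -
      have "a * 1 \<le> a * ((1 + 2 * a) * (1 - a))"
      proof (rule mult_left_mono)
        have "a * a \<le> 1/8 * a" using a0 by (intro mult_right_mono)
        then show "1 \<le> (1 + 2 * a) * (1 - a)" using a0 by (simp add: algebra_simps)
      qed (use a0 in auto)
      then show ?thesis
        using a0 by (simp add: divide_simps) (simp add: algebra_simps power2_eq_square)
    qed
    finally have "1 / (1 - a) \<le> exp (a + 2 * a\<^sup>2)" by simp
    then show "exp (- (a * t)) / (1 - a) \<le> exp (- (a * t)) * exp (a + 2 * a\<^sup>2)"
      using mult_left_mono[of "1 / (1 - a)" "exp (a + 2 * a\<^sup>2)" "exp (- (a * t))"] by simp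
    show "1 - z \<le> exp (- z)"
      using exp_ge_add_one_self[of "- z"] by simp
    have "exp (- ((1 - a) * t)) \<le> 1"
      using a0 assms(1) by simp
    then have "2 * \<theta> * exp (- ((1 - a) * t)) \<le> 2 * (1 / 8) * 1"
      using assms by (intro mult_mono) auto
    then have "z \<le> 1"
      using c0 by (simp add: z_def field_simps)
    then show "0 \<le> 1 - z" by simp
  qed auto
  also have "\<dots> = exp (- (a * t) + a + 2 * a\<^sup>2 - z)"
    by (simp add: exp_add exp_diff exp_minus field_simps)
  also have "\<dots> \<le> exp (- (2 * \<theta> / exp 1) + 4 * \<theta>\<^sup>2)"
  proof -
    have "a * (2 - t) - 2 * \<theta> * c \<le> z"
    proof -
      \<comment> \<open>The left side is the tangent of exp (-t) at t = 1. This is where the choice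
        of \<open>tilt\<close> as the slope at 1 pays off: the terms linear in \<open>t\<close>
        cancel in the final exponent.\<close>
      have "(2 - t) * w \<le> exp (- t)"
        using exp_ge_add_one_self[of "1 - t"] by (simp add: exp_diff exp_minus w_def field_simps)
      then have "2 * \<theta> * ((2 - t) * w) \<le> 2 * \<theta> * exp (- t)"
        using assms by (intro mult_left_mono) auto
      moreover have "2 * \<theta> * c * exp (- t) \<le> 2 * \<theta> * c * 1"
        using assms c0 by (intro mult_left_mono) auto
      ultimately have "a * (2 - t) - 2 * \<theta> * c \<le> 2 * \<theta> * exp (- t) * (1 - c)"
        by (simp add: a algebra_simps)
      also have "\<dots> \<le> 2 * \<theta> * exp (- t) * (1 / (1 + c))"
      proof (rule mult_left_mono)
        show "1 - c \<le> 1 / (1 + c)" using c0 by (simp add: field_simps)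
      qed (use assms in auto)
      also have "\<dots> \<le> 2 * \<theta> * exp (- ((1 - a) * t)) * (1 / (1 + c))"
        using assms a0 c0 by (intro mult_right_mono mult_left_mono) (auto simp: mult_left_le_one_le)
      finally show ?thesis by (simp add: z_def)
    qed
    moreover have "2 * a\<^sup>2 + 2 * \<theta> * c \<le> 4 * \<theta>\<^sup>2"
    proof -
      have "2 * a\<^sup>2 + 2 * \<theta> * c = 4 * \<theta>\<^sup>2 * (1 - w * (1 - 2 * w))"
        by (simp add: a c power2_eq_square algebra_simps)
      also have "\<dots> \<le> 4 * \<theta>\<^sup>2 * 1"
        using w by (intro mult_left_mono) auto
      finally show ?thesis by simp
    qed
    moreover have "2 * \<theta> / exp 1 = a"
      by (simp add: a w_def)
    ultimately show ?thesis
      by (simp add: algebra_simps)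
  qed
  finally show ?thesis .
qed

text \<open>The exponential weight lacks its normalizing factor \<open>p\<close>, whence the
  division by \<open>p\<close> on the right. Each side of \<open>y\<close> has an explicit
  antiderivative, and the total is the closed form above at \<open>t = p * y\<close>, divided by
  \<open>p\<close>.\<close>

lemma tilted_laplace_bound:
  fixes p y \<theta> :: real
  assumes p: "0 < p" and y: "0 \<le> y" and \<theta>: "0 \<le> \<theta>" "\<theta> \<le> 1 / 8"
  shows "(\<integral>\<^sup>+x. ennreal (exp (- (p * x)) * exp (- (p * \<theta> * (\<bar>x - y\<bar> + tilt * (x - y))))) * indicator {0..} x \<partial>lborel)
    \<le> ennreal (exp (- (2 * \<theta> / exp 1) + 4 * \<theta>\<^sup>2) / p)"
proof -
  define a c where "a = \<theta> * (1 - tilt)" and "c = \<theta> * (1 + tilt)"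
  have c0: "0 \<le> c" and a1: "a < 1"
    using tilt_bounds \<theta> mult_mono[of \<theta> "1/8" "1 - tilt" 1] by (auto simp: a_def c_def)
  let ?f = "\<lambda>x. exp (- (p * x) - p * a * (y - x))"
  let ?h = "\<lambda>x. exp (- (p * x) - p * c * (x - y))"
  have "(\<integral>\<^sup>+x. ennreal (exp (- (p * x)) * exp (- (p * \<theta> * (\<bar>x - y\<bar> + tilt * (x - y))))) * indicator {0..} x \<partial>lborel)
      \<le> (\<integral>\<^sup>+x. ennreal (?f x) * indicator {0..y} x + ennreal (?h x) * indicator {y..} x \<partial>lborel)"
  \<comment> \<open>Only an inequality holds pointwise, as both closed intervals contain
    \<open>y\<close>.\<close>
  proof (intro nn_integral_mono)
    fix x :: real
    have "exp (- (p * x)) * exp (- (p * \<theta> * (\<bar>x - y\<bar> + tilt * (x - y)))) = ?f x" if "x \<le> y"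
      using that by (simp add: a_def algebra_simps flip: exp_add)
    moreover have "exp (- (p * x)) * exp (- (p * \<theta> * (\<bar>x - y\<bar> + tilt * (x - y)))) = ?h x" if "y \<le> x"
      using that by (simp add: c_def algebra_simps flip: exp_add)
    ultimately show "ennreal (exp (- (p * x)) * exp (- (p * \<theta> * (\<bar>x - y\<bar> + tilt * (x - y))))) * indicator {0..} x
        \<le> ennreal (?f x) * indicator {0..y} x + ennreal (?h x) * indicator {y..} x"
      by (cases "x \<le> y") (auto simp: indicator_def)
  qed
  also have "\<dots> = (\<integral>\<^sup>+x. ennreal (?f x) * indicator {0..y} x \<partial>lborel) + (\<integral>\<^sup>+x. ennreal (?h x) * indicator {y..} x \<partial>lborel)"
    by (intro nn_integral_add) auto
  also have "(\<integral>\<^sup>+x. ennreal (?f x) * indicator {0..y} x \<partial>lborel) =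
      ennreal (- ?f y / (p * (1 - a)) - (- ?f 0 / (p * (1 - a))))"
  proof (rule nn_integral_FTC_Icc[where F = "\<lambda>x. - ?f x / (p * (1 - a))"])
    fix x
    show "((\<lambda>x. - ?f x / (p * (1 - a))) has_real_derivative ?f x) (at x)"
    proof -
      have "((\<lambda>x. - ?f x / (p * (1 - a))) has_real_derivative - (?f x * (- p + p * a)) / (p * (1 - a))) (at x)"
        using p a1 by (auto intro!: derivative_eq_intros)
      also have "- (?f x * (- p + p * a)) / (p * (1 - a)) = ?f x * ((p * (1 - a)) / (p * (1 - a)))"
        by (simp only: times_divide_eq_right) (simp add: algebra_simps)
      also have "(p * (1 - a)) / (p * (1 - a)) = 1"
        using p a1 by simp
      finally show ?thesis
        by simp
    qed
  qed (use y in auto)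
  also have "(\<integral>\<^sup>+x. ennreal (?h x) * indicator {y..} x \<partial>lborel) = ennreal (0 - (- ?h y / (p * (1 + c))))"
  proof (rule nn_integral_FTC_atLeast[where F = "\<lambda>x. - ?h x / (p * (1 + c))"])
    fix x
    show "((\<lambda>x. - ?h x / (p * (1 + c))) has_real_derivative ?h x) (at x)"
    proof -
      have "((\<lambda>x. - ?h x / (p * (1 + c))) has_real_derivative - (?h x * (- p - p * c)) / (p * (1 + c))) (at x)"
        using p c0 by (auto intro!: derivative_eq_intros)
      also have "- (?h x * (- p - p * c)) / (p * (1 + c)) = ?h x * ((p * (1 + c)) / (p * (1 + c)))"
        by (simp only: times_divide_eq_right) (simp add: algebra_simps)
      also have "(p * (1 + c)) / (p * (1 + c)) = 1"
        using p c0 by simp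
      finally show ?thesis
        by simp
    qed
  next
    have "((\<lambda>x. - (exp (p * c * y) * exp (- (p * (1 + c) * x))) / (p * (1 + c))) \<longlongrightarrow> - (exp (p * c * y) * 0) / (p * (1 + c))) at_top"
    proof (intro tendsto_intros)
      have "filterlim (\<lambda>x. p * (1 + c) * x) at_top at_top"
        using p c0 by (intro filterlim_tendsto_pos_mult_at_top[OF tendsto_const]) (auto simp: filterlim_ident)
      then show "((\<lambda>x. exp (- (p * (1 + c) * x))) \<longlongrightarrow> 0) at_top"
        by (intro filterlim_compose[OF exp_at_bot]) (simp add: filterlim_uminus_at_top)
    qed (use p c0 in auto)
    moreover have "- ?h x / (p * (1 + c)) = - (exp (p * c * y) * exp (- (p * (1 + c) * x))) / (p * (1 + c))" for x
      by (simp flip: exp_add add: algebra_simps)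
    ultimately show "((\<lambda>x. - ?h x / (p * (1 + c))) \<longlongrightarrow> 0) at_top"
      by (simp only: mult_zero_right minus_zero div_0)
  qed auto
  also have "ennreal (- ?f y / (p * (1 - a)) - (- ?f 0 / (p * (1 - a)))) + ennreal (0 - (- ?h y / (p * (1 + c))))
      = ennreal (((exp (- (a * (p * y))) - exp (- (p * y))) / (1 - a) + exp (- (p * y)) / (1 + c)) / p)"
  proof -
    have "exp (- (p * y)) \<le> exp (- (a * (p * y)))"
      using mult_right_mono[of a 1 "p * y"] p y a1 by simp
    then have "0 \<le> (exp (- (a * (p * y))) - exp (- (p * y))) / (p * (1 - a))"
      using p a1 by simp
    moreover have "- ?f y / (p * (1 - a)) - (- ?f 0 / (p * (1 - a))) = (exp (- (a * (p * y))) - exp (- (p * y))) / (p * (1 - a))"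
      by (simp add: diff_divide_distrib algebra_simps)
    ultimately show ?thesis
      using p c0 by (simp flip: ennreal_plus add: add_divide_distrib mult.commute)
  qed
  also have "\<dots> \<le> ennreal (exp (- (2 * \<theta> / exp 1) + 4 * \<theta>\<^sup>2) / p)"
    using p y \<theta> tilted_laplace_closed_form_le[of "p * y" \<theta>]
    by (intro ennreal_leI divide_right_mono) (auto simp: a_def c_def)
  finally show ?thesis .
qed

section \<open>From one coordinate to a point of the simplex and to tuples\<close>

text \<open>Both points have coordinate sum 1, so the difference in the last coordinate is minus the
  sum of the other differences. Its absolute value pays for the tilt because \<open>tilt\<close>
  lies between 0 and 1.\<close>

lemma tvd_add_last_coord_ge:
  assumes "0 < N" and "(\<Sum>i<N. y i) = 1"
  shows "(\<Sum>j<N - 1. \<bar>x j - y j\<bar> + tilt * (x j - y j)) \<le> tvd N (add_last_coord N x) y"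
proof -
  obtain M where N: "N = Suc M"
    using assms(1) by (cases N) auto
  have "tilt * (\<Sum>j<M. x j - y j) = tilt * (y M - (1 - (\<Sum>j<M. x j)))"
    using assms(2) by (simp add: N sum_subtractf)
  also have "\<dots> \<le> \<bar>tilt * (y M - (1 - (\<Sum>j<M. x j)))\<bar>"
    by (rule abs_ge_self)
  also have "\<dots> \<le> \<bar>y M - (1 - (\<Sum>j<M. x j))\<bar>"
    using tilt_bounds by (simp add: abs_mult mult_left_le_one_le)
  finally show ?thesis
    by (simp add: N tvd_def add_last_coord_def sum.distrib sum_distrib_left abs_minus_commute)
qed

text \<open>Comparison with independent exponential variables makes the integral a product over
  \<open>N - 1\<close> coordinates, each contributing at most \<open>q / N\<close>. The constants
  collect to (N-1)! e^N / N^(N-1), which is at most e N.\<close>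

lemma nn_integral_uniform_simplex_le:
  assumes N: "0 < N" and y: "\<And>i. i < N \<Longrightarrow> 0 \<le> y i" "(\<Sum>i<N. y i) = 1"
    and \<theta>: "0 \<le> \<theta>" "\<theta> \<le> 1 / 8"
  shows "(\<integral>\<^sup>+x. ennreal (exp (- (real N * \<theta> * tvd N x y))) \<partial>uniform_simplex N)
    \<le> ennreal (exp 1 * real N * exp (- (2 * \<theta> / exp 1) + 4 * \<theta>\<^sup>2) ^ (N - 1))"
proof -
  let ?M = "Pi\<^sub>M {..<N - 1} (\<lambda>_. lborel :: real measure)"
  define q where "q = exp (- (2 * \<theta> / exp 1) + 4 * \<theta>\<^sup>2)"
  define h where "h j x = exp (- (real N * x)) * exp (- (real N * \<theta> * (\<bar>x - y j\<bar> + tilt * (x - y j))))"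
    for j and x :: real
  have h_nonneg: "0 \<le> h j x" for j x
    by (simp add: h_def)
  have [measurable]: "h j \<in> borel_measurable borel" for j
    unfolding h_def by measurable
  have [measurable]: "corner_simplex N \<in> sets ?M"
    by (rule corner_simplex_in_sets)
  have tvd [measurable]: "(\<lambda>x. tvd N x y) \<in> borel_measurable (Pi\<^sub>M {..<N} (\<lambda>_. borel))"
    unfolding tvd_def by measurable
  have add [measurable]: "add_last_coord N \<in> uniform_measure ?M (corner_simplex N) \<rightarrow>\<^sub>M Pi\<^sub>M {..<N} (\<lambda>_. borel)"
    using measurable_add_last_coord[of N]
    by (subst measurable_cong_sets[OF sets_uniform_measure refl])
  have "(\<integral>\<^sup>+x. ennreal (exp (- (real N * \<theta> * tvd N x y))) \<partial>uniform_simplex N)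
      = (\<integral>\<^sup>+x. ennreal (exp (- (real N * \<theta> * tvd N (add_last_coord N x) y))) \<partial>uniform_measure ?M (corner_simplex N))"
    unfolding uniform_simplex_def by (rule nn_integral_distr[OF add]) measurable
  also have "\<dots> = (\<integral>\<^sup>+x. ennreal (exp (- (real N * \<theta> * tvd N (add_last_coord N x) y)))
      * indicator (corner_simplex N) x \<partial>?M) / emeasure ?M (corner_simplex N)"
    by (rule nn_integral_uniform_measure) measurable
  also have "\<dots> = ennreal (fact (N - 1)) * (\<integral>\<^sup>+x. ennreal (exp (- (real N * \<theta> * tvd N (add_last_coord N x) y)))
      * indicator (corner_simplex N) x \<partial>?M)"
    unfolding emeasure_corner_simplex divide_ennreal_def
    by (subst inverse_ennreal) (auto simp: mult.commute)
  also have "(\<integral>\<^sup>+x. ennreal (exp (- (real N * \<theta> * tvd N (add_last_coord N x) y)))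
      * indicator (corner_simplex N) x \<partial>?M)
      \<le> (\<integral>\<^sup>+x. ennreal (exp (real N)) * (\<Prod>j<N - 1. ennreal (h j (x j)) * indicator {0..} (x j)) \<partial>?M)"
  proof (rule nn_integral_mono)
    fix x
    show "ennreal (exp (- (real N * \<theta> * tvd N (add_last_coord N x) y))) * indicator (corner_simplex N) x
      \<le> ennreal (exp (real N)) * (\<Prod>j<N - 1. ennreal (h j (x j)) * indicator {0..} (x j))"
    proof (cases "x \<in> corner_simplex N")
      case True
      then have x: "\<And>j. j < N - 1 \<Longrightarrow> 0 \<le> x j" "(\<Sum>j<N - 1. x j) \<le> 1"
        by (auto simp: corner_simplex_def)
      \<comment> \<open>The factor exp (N (1 - \<Sum> x)) is at least 1 on the corner simplex;
        inserting it produces the exponential weights of mean 1/N, up to the constant e^N.\<close>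
      have "exp (- (real N * \<theta> * tvd N (add_last_coord N x) y))
          \<le> exp (real N * (1 - (\<Sum>j<N - 1. x j)) - real N * \<theta> * (\<Sum>j<N - 1. \<bar>x j - y j\<bar> + tilt * (x j - y j)))"
      proof -
        have "0 \<le> real N * (1 - (\<Sum>j<N - 1. x j))"
          using x(2) by simp
        moreover have "real N * \<theta> * (\<Sum>j<N - 1. \<bar>x j - y j\<bar> + tilt * (x j - y j))
            \<le> real N * \<theta> * tvd N (add_last_coord N x) y"
          using N y(2) \<theta>(1) by (intro mult_left_mono tvd_add_last_coord_ge) auto
        ultimately show ?thesis
          by simp
      qed
      also have "\<dots> = exp (real N) * (\<Prod>j<N - 1. h j (x j))"
        unfolding h_def by (simp add: exp_sum[symmetric] algebra_simps sum.distrib sum_distrib_left sum_subtractf flip: exp_add)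
      finally have "ennreal (exp (- (real N * \<theta> * tvd N (add_last_coord N x) y)))
          \<le> ennreal (exp (real N) * (\<Prod>j<N - 1. h j (x j)))"
        by (rule ennreal_leI)
      also have "\<dots> = ennreal (exp (real N)) * (\<Prod>j<N - 1. ennreal (h j (x j)))"
        by (subst ennreal_mult) (auto simp: h_nonneg prod_nonneg prod_ennreal)
      also have "(\<Prod>j<N - 1. ennreal (h j (x j))) = (\<Prod>j<N - 1. ennreal (h j (x j)) * indicator {0..} (x j))"
        using x(1) by (intro prod.cong) auto
      finally show ?thesis
        using True by simp
    qed simp
  qed
  also have "\<dots> = ennreal (exp (real N)) * (\<Prod>j<N - 1. \<integral>\<^sup>+x. ennreal (h j x) * indicator {0..} x \<partial>lborel)"
  proof -
    interpret product_sigma_finite "\<lambda>_. lborel :: real measure"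
      by standard
    show ?thesis
      by (subst nn_integral_cmult, measurable)
         (subst product_nn_integral_prod[where f = "\<lambda>j x. ennreal (h j x) * indicator {0..} x"], auto)
  qed
  also have "(\<Prod>j<N - 1. \<integral>\<^sup>+x. ennreal (h j x) * indicator {0..} x \<partial>lborel) \<le> (\<Prod>j<N - 1. ennreal (q / real N))"
    using N y(1) \<theta> unfolding h_def q_def by (intro prod_mono_ennreal tilted_laplace_bound) auto
  also have "\<dots> = ennreal ((q / real N) ^ (N - 1))"
    by (simp add: ennreal_power q_def)
  also have "ennreal (fact (N - 1)) * (ennreal (exp (real N)) * ennreal ((q / real N) ^ (N - 1)))
      = ennreal (fact (N - 1) * exp (real N) * (q / real N) ^ (N - 1))"
    by (simp add: ennreal_mult' q_def mult.assoc)
  also have "\<dots> \<le> ennreal (exp 1 * real N * q ^ (N - 1))"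
  proof (rule ennreal_leI)
    obtain n where n: "N = Suc n"
      using N by (cases N) auto
    have "fact n * exp (real (Suc n)) = exp 1 * (fact n * exp (real n))"
      by (simp add: exp_add)
    also have "\<dots> \<le> exp 1 * real (Suc n) ^ Suc n"
      by (intro mult_left_mono fact_mult_exp_le) auto
    finally have "fact n * exp (real (Suc n)) / real (Suc n) ^ n \<le> exp 1 * real (Suc n)"
      by (simp add: field_simps)
    then have "fact n * exp (real (Suc n)) / real (Suc n) ^ n * q ^ n \<le> exp 1 * real (Suc n) * q ^ n"
      by (rule mult_right_mono) (simp add: q_def)
    then show "fact (N - 1) * exp (real N) * (q / real N) ^ (N - 1) \<le> exp 1 * real N * q ^ (N - 1)"
      by (simp add: n power_divide)
  qed
  finally show ?thesis
    unfolding q_def by (meson mult_left_mono order_trans zero_le)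
qed

text \<open>Chernoff's bound for the lower tail of the total distance: the \<open>k\<close>
  components are independent, so the Laplace transform is the \<open>k\<close>-th power of the bound
  for a single point.\<close>

lemma measure_avg_tvd_le:
  fixes d :: real
  assumes N: "0 < N" and k: "0 < k"
    and y: "\<And>i j. i < k \<Longrightarrow> j < N \<Longrightarrow> 0 \<le> y i j" "\<And>i. i < k \<Longrightarrow> (\<Sum>j<N. y i j) = 1"
    and \<theta>: "0 \<le> \<theta>" "\<theta> \<le> 1 / 8"
  defines "A \<equiv> {x \<in> space (uniform_simplex_tuples N k). avg_tvd N k x y \<le> d}"
  shows "A \<in> sets (uniform_simplex_tuples N k)"
    and "measure (uniform_simplex_tuples N k) A
      \<le> (exp 1 * real N * exp (real N * \<theta> * d) * exp (- (2 * \<theta> / exp 1) + 4 * \<theta>\<^sup>2) ^ (N - 1)) ^ k"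
proof -
  interpret P: prob_space "uniform_simplex N"
    by (rule prob_space_uniform_simplex)
  interpret product_sigma_finite "\<lambda>_. uniform_simplex N"
    by standard
  interpret Q: prob_space "uniform_simplex_tuples N k"
    unfolding uniform_simplex_tuples_def by (intro prob_space_PiM prob_space_uniform_simplex)
  let ?C = "exp 1 * real N * exp (- (2 * \<theta> / exp 1) + 4 * \<theta>\<^sup>2) ^ (N - 1)"
  have C0: "0 \<le> ?C"
    by simp
  have tvd [measurable]: "(\<lambda>x. tvd N x z) \<in> borel_measurable (uniform_simplex N)" for z
    unfolding tvd_def by (subst measurable_cong_sets[OF sets_uniform_simplex refl]) measurable
  have [measurable]: "(\<lambda>x. avg_tvd N k x y) \<in> borel_measurable (uniform_simplex_tuples N k)"
    unfolding avg_tvd_def uniform_simplex_tuples_def by measurable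
  show A: "A \<in> sets (uniform_simplex_tuples N k)"
    unfolding A_def by measurable
  have "emeasure (uniform_simplex_tuples N k) A = (\<integral>\<^sup>+x. indicator A x \<partial>uniform_simplex_tuples N k)"
    using A by simp
  also have "\<dots> \<le> (\<integral>\<^sup>+x. ennreal (exp (real N * \<theta> * (real k * d)))
      * (\<Prod>i<k. ennreal (exp (- (real N * \<theta> * tvd N (x i) (y i))))) \<partial>uniform_simplex_tuples N k)"
  \<comment> \<open>Exponential Markov inequality: on \<open>A\<close> the integrand on the right is
    at least 1.\<close>
  proof (intro nn_integral_mono)
    fix x
    show "indicator A x \<le> ennreal (exp (real N * \<theta> * (real k * d))) * (\<Prod>i<k. ennreal (exp (- (real N * \<theta> * tvd N (x i) (y i)))))"
    proof (cases "x \<in> A")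
      case True
      then have "(\<Sum>i<k. tvd N (x i) (y i)) \<le> real k * d"
        using k by (simp add: A_def avg_tvd_def field_simps)
      then have "real N * \<theta> * (\<Sum>i<k. tvd N (x i) (y i)) \<le> real N * \<theta> * (real k * d)"
        using \<theta> by (intro mult_left_mono) auto
      then have "1 \<le> exp (real N * \<theta> * (real k * d) - real N * \<theta> * (\<Sum>i<k. tvd N (x i) (y i)))"
        by simp
      also have "\<dots> = exp (real N * \<theta> * (real k * d)) * (\<Prod>i<k. exp (- (real N * \<theta> * tvd N (x i) (y i))))"
        by (simp add: exp_sum[symmetric] sum_negf sum_distrib_left flip: exp_add)
      finally have "ennreal 1 \<le> ennreal (exp (real N * \<theta> * (real k * d)) * (\<Prod>i<k. exp (- (real N * \<theta> * tvd N (x i) (y i)))))"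
        by (rule ennreal_leI)
      also have "\<dots> = ennreal (exp (real N * \<theta> * (real k * d))) * (\<Prod>i<k. ennreal (exp (- (real N * \<theta> * tvd N (x i) (y i)))))"
        by (subst ennreal_mult) (auto simp: prod_nonneg prod_ennreal)
      finally show ?thesis
        using True by simp
    qed simp
  qed
  also have "\<dots> = ennreal (exp (real N * \<theta> * (real k * d)))
      * (\<Prod>i<k. \<integral>\<^sup>+x. ennreal (exp (- (real N * \<theta> * tvd N x (y i)))) \<partial>uniform_simplex N)"
    unfolding uniform_simplex_tuples_def
    by (subst nn_integral_cmult, measurable)
       (subst product_nn_integral_prod[where f = "\<lambda>i x. ennreal (exp (- (real N * \<theta> * tvd N x (y i))))"], auto)
  also have "\<dots> \<le> ennreal (exp (real N * \<theta> * (real k * d))) * (\<Prod>i<k. ennreal ?C)"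
    using assms by (intro mult_left_mono prod_mono_ennreal nn_integral_uniform_simplex_le) auto
  also have "\<dots> = ennreal (exp (real N * \<theta> * (real k * d)) * ?C ^ k)"
    using ennreal_mult[OF exp_ge_zero zero_le_power[OF C0]] ennreal_power[OF C0, symmetric]
    by (simp only: prod_constant card_lessThan)
  also have "exp (real N * \<theta> * (real k * d)) = exp (real N * \<theta> * d) ^ k"
    by (simp add: exp_of_nat_mult[symmetric] algebra_simps)
  also have "\<dots> * ?C ^ k = (exp 1 * real N * exp (real N * \<theta> * d) * exp (- (2 * \<theta> / exp 1) + 4 * \<theta>\<^sup>2) ^ (N - 1)) ^ k"
    by (simp add: power_mult_distrib algebra_simps)
  finally show "measure (uniform_simplex_tuples N k) A
      \<le> (exp 1 * real N * exp (real N * \<theta> * d) * exp (- (2 * \<theta> / exp 1) + 4 * \<theta>\<^sup>2) ^ (N - 1)) ^ k"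
    by (simp add: Q.emeasure_eq_measure)
qed

section \<open>Gates as isometries\<close>

definition from_bits :: "nat \<Rightarrow> (nat \<Rightarrow> bool) \<Rightarrow> nat" where
  "from_bits n P = (\<Sum>q<n. of_bool (P q) * 2 ^ q)"

text \<open>Gives access to the theory of bits of Horner sums.\<close>

lemma from_bits_eq_horner_sum: "from_bits n P = horner_sum of_bool 2 (map P [0..<n])"
  by (simp add: from_bits_def horner_sum_eq_sum atLeast0LessThan)

lemma bit_from_bits_iff: "bit (from_bits n P) q \<longleftrightarrow> q < n \<and> P q"
  by (auto simp: from_bits_eq_horner_sum bit_horner_sum_bit_iff)

lemma from_bits_less: "from_bits n P < 2 ^ n"
proof -
  have "take_bit n (from_bits n P) = from_bits n P"
    by (rule bit_eqI) (simp add: bit_take_bit_iff bit_from_bits_iff)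
  then show ?thesis
    by (simp add: take_bit_nat_eq_self_iff)
qed

lemma not_bit_nat_ge:
  fixes i :: nat
  assumes "i < 2 ^ n" "n \<le> q"
  shows "\<not> bit i q"
  using assms by (metis bit_take_bit_iff not_less take_bit_nat_eq_self)

lemma selected_index_eq_from_bits: "selected_index g s j = from_bits g (\<lambda>q. bit j (s q))"
  by (simp add: selected_index_def from_bits_def)

text \<open>The identification of H_n with the tensor product of H_(n-g) and H_g on basis indices:
  \<open>r\<close> is the set of unselected qubits with value 1, and \<open>t\<close> is the basis
  index seen by the gate.\<close>

definition glue_bits :: "nat \<Rightarrow> nat \<Rightarrow> (nat \<Rightarrow> nat) \<Rightarrow> nat set \<Rightarrow> nat \<Rightarrow> nat" where
  "glue_bits n g s r t = from_bits n (\<lambda>q. q \<in> r \<or> (\<exists>p<g. s p = q \<and> bit t p))"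

context
  fixes n g :: nat and s :: "nat \<Rightarrow> nat"
  assumes s: "s ` {..<g} \<subseteq> {..<n}" "inj_on s {..<g}"
begin

lemma selected_index_glue_bits:
  assumes "r \<subseteq> {..<n} - s ` {..<g}" "t < 2 ^ g"
  shows "selected_index g s (glue_bits n g s r t) = t"
proof (rule bit_eqI)
  fix q
  show "bit (selected_index g s (glue_bits n g s r t)) q \<longleftrightarrow> bit t q"
  proof (cases "q < g")
    case True
    then have "s q < n" "s q \<notin> r"
      using s assms(1) by auto
    moreover have "(\<exists>p<g. s p = s q \<and> bit t p) \<longleftrightarrow> bit t q"
      using True s(2) by (auto simp: inj_on_eq_iff)
    ultimately show ?thesis
      using True by (simp add: selected_index_eq_from_bits glue_bits_def bit_from_bits_iff)
  next
    case False
    then show ?thesis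
      using not_bit_nat_ge[OF assms(2), of q] by (simp add: selected_index_eq_from_bits bit_from_bits_iff)
  qed
qed

lemma bit_glue_bits_unselected:
  assumes "q < n" "q \<notin> s ` {..<g}"
  shows "bit (glue_bits n g s r t) q \<longleftrightarrow> q \<in> r"
  using assms by (auto simp: glue_bits_def bit_from_bits_iff)

lemma glue_bits_inverse:
  assumes "i < 2 ^ n"
  shows "glue_bits n g s {q \<in> {..<n} - s ` {..<g}. bit i q} (selected_index g s i) = i"
proof (rule bit_eqI)
  fix q
  show "bit (glue_bits n g s {q \<in> {..<n} - s ` {..<g}. bit i q} (selected_index g s i)) q \<longleftrightarrow> bit i q"
    using not_bit_nat_ge[OF assms, of q]
    by (cases "q < n") (auto simp: selected_index_eq_from_bits glue_bits_def bit_from_bits_iff)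
qed

lemma bij_betw_glue_bits:
  "bij_betw (\<lambda>(r, t). glue_bits n g s r t) (Pow ({..<n} - s ` {..<g}) \<times> {..<2 ^ g}) {..<2 ^ n}"
proof (rule bij_betw_byWitness[where f' = "\<lambda>i. ({q \<in> {..<n} - s ` {..<g}. bit i q}, selected_index g s i)"])
  show "\<forall>a\<in>Pow ({..<n} - s ` {..<g}) \<times> {..<2 ^ g}.
      (\<lambda>i. ({q \<in> {..<n} - s ` {..<g}. bit i q}, selected_index g s i)) (case a of (r, t) \<Rightarrow> glue_bits n g s r t) = a"
    by (auto simp: selected_index_glue_bits bit_glue_bits_unselected)
  show "\<forall>i\<in>{..<2 ^ n}. (case ({q \<in> {..<n} - s ` {..<g}. bit i q}, selected_index g s i) of (r, t) \<Rightarrow> glue_bits n g s r t) = i"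
    using glue_bits_inverse by simp
  show "(\<lambda>(r, t). glue_bits n g s r t) ` (Pow ({..<n} - s ` {..<g}) \<times> {..<2 ^ g}) \<subseteq> {..<2 ^ n}"
    by (auto simp: glue_bits_def from_bits_less)
  show "(\<lambda>i. ({q \<in> {..<n} - s ` {..<g}. bit i q}, selected_index g s i)) ` {..<2 ^ n}
      \<subseteq> Pow ({..<n} - s ` {..<g}) \<times> {..<2 ^ g}"
    by (auto simp: selected_index_eq_from_bits from_bits_less)
qed

lemma sum_glue_bits:
  "(\<Sum>i<2 ^ n. f i) = (\<Sum>r\<in>Pow ({..<n} - s ` {..<g}). \<Sum>t<2 ^ g. f (glue_bits n g s r t))"
  using sum.reindex_bij_betw[OF bij_betw_glue_bits, of f]
  by (simp add: sum.cartesian_product case_prod_unfold)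

text \<open>In these coordinates the gate is block diagonal: for every \<open>r\<close> it applies a
  copy of \<open>V\<close> to the \<open>2 ^ g\<close> entries belonging to
  \<open>r\<close>.\<close>

lemma apply_gate_mult_vec_index:
  assumes r: "r \<subseteq> {..<n} - s ` {..<g}" and t: "t < 2 ^ g" and w: "w \<in> carrier_vec (2 ^ n)"
  shows "vec_index (apply_gate n g s V *\<^sub>v w) (glue_bits n g s r t)
    = (\<Sum>t'<2 ^ g. V $$ (t, t') * vec_index w (glue_bits n g s r t'))"
proof -
  let ?R = "Pow ({..<n} - s ` {..<g})"
  have i: "glue_bits n g s r t < 2 ^ n"
    by (simp add: glue_bits_def from_bits_less)
  have "vec_index (apply_gate n g s V *\<^sub>v w) (glue_bits n g s r t)
      = (\<Sum>j<2 ^ n. apply_gate n g s V $$ (glue_bits n g s r t, j) * vec_index w j)"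
    using i w by (simp add: apply_gate_def scalar_prod_def atLeast0LessThan)
  also have "\<dots> = (\<Sum>r'\<in>?R. \<Sum>t'<2 ^ g. apply_gate n g s V $$ (glue_bits n g s r t, glue_bits n g s r' t')
      * vec_index w (glue_bits n g s r' t'))"
    by (rule sum_glue_bits)
  also have "\<dots> = (\<Sum>r'\<in>?R. if r' = r then \<Sum>t'<2 ^ g. V $$ (t, t') * vec_index w (glue_bits n g s r t') else 0)"
  proof (intro sum.cong refl)
    fix r' assume r': "r' \<in> ?R"
    \<comment> \<open>Agreement on all unselected qubits means lying in the same block, so a single
      term of the sum over \<open>r'\<close> survives.\<close>
    have unsel: "(\<forall>q<n. q \<notin> s ` {..<g} \<longrightarrow> bit (glue_bits n g s r t) q = bit (glue_bits n g s r' t') q) \<longleftrightarrow> r' = r" for t'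
      using r r' by (auto simp: bit_glue_bits_unselected)
    have "apply_gate n g s V $$ (glue_bits n g s r t, glue_bits n g s r' t') = (if r' = r then V $$ (t, t') else 0)"
      if t': "t' < 2 ^ g" for t'
    proof -
      have "glue_bits n g s r' t' < 2 ^ n"
        by (simp add: glue_bits_def from_bits_less)
      then show ?thesis
        using i r r' t t' by (simp add: apply_gate_def unsel selected_index_glue_bits del: all_simps)
    qed
    then show "(\<Sum>t'<2 ^ g. apply_gate n g s V $$ (glue_bits n g s r t, glue_bits n g s r' t')
        * vec_index w (glue_bits n g s r' t'))
      = (if r' = r then \<Sum>t'<2 ^ g. V $$ (t, t') * vec_index w (glue_bits n g s r t') else 0)"
      by simp
  qed
  also have "\<dots> = (\<Sum>t'<2 ^ g. V $$ (t, t') * vec_index w (glue_bits n g s r t'))"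
    using r by (subst sum.delta) (auto simp: finite_subset)
  finally show ?thesis .
qed

end

section \<open>The Euclidean norm and the action of gates on it\<close>

text \<open>Expressed through \<open>L2_set\<close> so that the triangle and Cauchy-Schwarz
  inequalities for \<open>L2_set\<close> apply directly.\<close>

definition vnorm :: "complex vec \<Rightarrow> real" where
  "vnorm v = L2_set (\<lambda>i. cmod (vec_index v i)) {..<dim_vec v}"

lemma vnorm_nonneg [simp]: "0 \<le> vnorm v"
  by (simp add: vnorm_def)

lemma vnorm_power2: "v \<in> carrier_vec d \<Longrightarrow> (vnorm v)\<^sup>2 = (\<Sum>i<d. (cmod (vec_index v i))\<^sup>2)"
  by (auto simp: vnorm_def L2_set_def sum_nonneg)

lemma vnorm_triangle:
  assumes "u \<in> carrier_vec d" "v \<in> carrier_vec d"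
  shows "vnorm (u + v) \<le> vnorm u + vnorm v"
proof -
  have "vnorm (u + v) \<le> L2_set (\<lambda>i. cmod (vec_index u i) + cmod (vec_index v i)) {..<d}"
    using assms unfolding vnorm_def by (auto intro!: L2_set_mono norm_triangle_ineq)
  also have "\<dots> \<le> vnorm u + vnorm v"
    using assms L2_set_triangle_ineq[of "\<lambda>i. cmod (vec_index u i)" "\<lambda>i. cmod (vec_index v i)" "{..<d}"]
    by (simp add: vnorm_def)
  finally show ?thesis .
qed

definition isometric :: "nat \<Rightarrow> complex mat \<Rightarrow> bool" where
  "isometric d U \<longleftrightarrow> U \<in> carrier_mat d d \<and> (\<forall>w\<in>carrier_vec d. vnorm (U *\<^sub>v w) = vnorm w)"

lemma apply_gate_carrier [simp]: "apply_gate n g s V \<in> carrier_mat (2 ^ n) (2 ^ n)"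
  by (simp add: apply_gate_def)

lemma vnorm_apply_gate_power2:
  assumes "s ` {..<g} \<subseteq> {..<n}" "inj_on s {..<g}" and w: "w \<in> carrier_vec (2 ^ n)"
  shows "(vnorm (apply_gate n g s V *\<^sub>v w))\<^sup>2 = (\<Sum>r\<in>Pow ({..<n} - s ` {..<g}). \<Sum>t<2 ^ g.
      (cmod (\<Sum>t'<2 ^ g. V $$ (t, t') * vec_index w (glue_bits n g s r t')))\<^sup>2)"
  using w mult_mat_vec_carrier[OF apply_gate_carrier w]
  by (subst vnorm_power2[of _ "2 ^ n"])
     (auto simp: sum_glue_bits[OF assms(1,2)] apply_gate_mult_vec_index[OF assms(1,2)] intro!: sum.cong)

lemma unitary_mats_columns:
  assumes "V \<in> unitary_mats d" "j < d" "l < d"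
  shows "(\<Sum>i<d. cnj (V $$ (i, j)) * V $$ (i, l)) = (if j = l then 1 else 0)"
proof -
  have V: "V \<in> carrier_mat d d" and inv: "inverts_mat (mat_adjoint V) V"
    using assms(1) by (auto simp: unitary_mats_def)
  have adj: "mat_adjoint V \<in> carrier_mat d d"
    using V by (auto simp: mat_adjoint_def intro!: carrier_matI)
  have "(mat_adjoint V * V) $$ (j, l) = (\<Sum>i<d. cnj (V $$ (i, j)) * V $$ (i, l))"
    using V assms(2,3) by (simp add: mat_adjoint_def scalar_prod_def mat_of_rows_def atLeast0LessThan)
  moreover have "mat_adjoint V * V = 1\<^sub>m d"
    using inv adj by (simp add: inverts_mat_def)
  ultimately show ?thesis
    using assms(2,3) by simp
qed

text \<open>Expand the squares and use that the columns are orthonormal. Taking a function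
  \<open>u\<close> instead of a vector lets the identity be applied to each block of
  entries.\<close>

lemma unitary_mats_norm:
  assumes "V \<in> unitary_mats d"
  shows "(\<Sum>i<d. (cmod (\<Sum>j<d. V $$ (i, j) * u j))\<^sup>2) = (\<Sum>j<d. (cmod (u j))\<^sup>2)"
proof -
  have "complex_of_real (\<Sum>i<d. (cmod (\<Sum>j<d. V $$ (i, j) * u j))\<^sup>2)
      = (\<Sum>i<d. (\<Sum>l<d. V $$ (i, l) * u l) * (\<Sum>j<d. cnj (V $$ (i, j)) * cnj (u j)))"
    by (simp add: complex_norm_square del: of_real_power)
  also have "\<dots> = (\<Sum>i<d. \<Sum>l<d. \<Sum>j<d. cnj (u j) * u l * (cnj (V $$ (i, j)) * V $$ (i, l)))"
    by (simp add: sum_product algebra_simps)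
  also have "\<dots> = (\<Sum>l<d. \<Sum>j<d. \<Sum>i<d. cnj (u j) * u l * (cnj (V $$ (i, j)) * V $$ (i, l)))"
    by (subst sum.swap, rule sum.cong[OF refl], rule sum.swap)
  also have "\<dots> = (\<Sum>l<d. \<Sum>j<d. cnj (u j) * u l * (if j = l then 1 else 0))"
    using assms by (intro sum.cong refl) (simp add: unitary_mats_columns flip: sum_distrib_left)
  also have "\<dots> = (\<Sum>l<d. cnj (u l) * u l)"
    by (simp add: if_distrib cong: if_cong)
  also have "\<dots> = complex_of_real (\<Sum>j<d. (cmod (u j))\<^sup>2)"
    by (simp add: complex_norm_square mult.commute del: of_real_power)
  finally show ?thesis
    by (simp only: of_real_eq_iff)
qed

text \<open>Column \<open>j\<close> is the image of a basis vector and hence has norm 1.\<close>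

lemma unitary_mats_entry_le:
  assumes "V \<in> unitary_mats d" "i < d" "j < d"
  shows "cmod (V $$ (i, j)) \<le> 1"
proof -
  have "(cmod (V $$ (i, j)))\<^sup>2 \<le> (\<Sum>i<d. (cmod (V $$ (i, j)))\<^sup>2)"
    using assms(2) by (intro member_le_sum) auto
  also have "\<dots> = (\<Sum>i<d. (cmod (\<Sum>l<d. V $$ (i, l) * (if l = j then 1 else 0)))\<^sup>2)"
    using assms(3) by (simp add: if_distrib cong: if_cong)
  also have "\<dots> = (\<Sum>l<d. (cmod (if l = j then 1 else 0))\<^sup>2)"
    by (rule unitary_mats_norm[OF assms(1)])
  also have "\<dots> = (\<Sum>l<d. if l = j then 1 else 0)"
    by (intro sum.cong) auto
  also have "\<dots> = 1"
    using assms(3) by simp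
  finally show ?thesis
    by (simp add: power_le_one_iff abs_square_le_1)
qed

lemma isometric_apply_gate:
  assumes s: "s ` {..<g} \<subseteq> {..<n}" "inj_on s {..<g}" and V: "V \<in> unitary_mats (2 ^ g)"
  shows "isometric (2 ^ n) (apply_gate n g s V)"
  unfolding isometric_def
proof (intro conjI ballI)
  fix w :: "complex vec" assume w: "w \<in> carrier_vec (2 ^ n)"
  have "(vnorm (apply_gate n g s V *\<^sub>v w))\<^sup>2 = (vnorm w)\<^sup>2"
    using V by (simp add: vnorm_apply_gate_power2[OF s w] unitary_mats_norm vnorm_power2[OF w] sum_glue_bits[OF s])
  then show "vnorm (apply_gate n g s V *\<^sub>v w) = vnorm w"
    by simp
qed simp

text \<open>Within a block every output entry is at most \<eta> times the sum of the moduli of the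
  inputs. Cauchy-Schwarz and the summation over \<open>2 ^ g\<close> outputs each cost a factor
  2^(g/2), so the bound depends on \<open>g\<close> and not on \<open>n\<close>.\<close>

lemma vnorm_apply_gate_le:
  assumes s: "s ` {..<g} \<subseteq> {..<n}" "inj_on s {..<g}" and w: "w \<in> carrier_vec (2 ^ n)"
    and V: "\<And>i j. i < 2 ^ g \<Longrightarrow> j < 2 ^ g \<Longrightarrow> cmod (V $$ (i, j)) \<le> \<eta>"
  shows "vnorm (apply_gate n g s V *\<^sub>v w) \<le> \<eta> * 2 ^ g * vnorm w"
proof -
  have \<eta>: "0 \<le> \<eta>"
    using order_trans[OF norm_ge_zero V[of 0 0]] by simp
  have *: "(\<Sum>t<2 ^ g. (cmod (\<Sum>t'<2 ^ g. V $$ (t, t') * u t'))\<^sup>2) \<le> (\<eta> * 2 ^ g)\<^sup>2 * (\<Sum>t<2 ^ g. (cmod (u t))\<^sup>2)"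
    (is "?L \<le> _") for u :: "nat \<Rightarrow> complex"
  proof -
    have "?L \<le> (\<Sum>t<(2::nat) ^ g. (\<eta> * (\<Sum>t'<2 ^ g. cmod (u t')))\<^sup>2)"
    proof (intro sum_mono power_mono norm_ge_zero)
      fix t :: nat assume t: "t \<in> {..<2 ^ g}"
      have "cmod (\<Sum>t'<2 ^ g. V $$ (t, t') * u t') \<le> (\<Sum>t'<2 ^ g. \<eta> * cmod (u t'))"
        using V t by (intro sum_norm_le) (auto simp: norm_mult intro!: mult_right_mono)
      then show "cmod (\<Sum>t'<2 ^ g. V $$ (t, t') * u t') \<le> \<eta> * (\<Sum>t'<2 ^ g. cmod (u t'))"
        by (simp add: sum_distrib_left)
    qed
    also have "\<dots> = 2 ^ g * \<eta>\<^sup>2 * (\<Sum>t'<(2::nat) ^ g. cmod (u t'))\<^sup>2"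
      by (simp add: power_mult_distrib)
    also have "\<dots> \<le> 2 ^ g * \<eta>\<^sup>2 * (2 ^ g * (\<Sum>t<2 ^ g. (cmod (u t))\<^sup>2))"
      using sum_squared_le_sum_of_squares[of "\<lambda>t. cmod (u t)" "{..<2 ^ g}"]
      by (intro mult_left_mono) (auto simp: mult.commute)
    finally show ?thesis
      by (simp add: power2_eq_square algebra_simps)
  qed
  have "(vnorm (apply_gate n g s V *\<^sub>v w))\<^sup>2
      \<le> (\<Sum>r\<in>Pow ({..<n} - s ` {..<g}). (\<eta> * 2 ^ g)\<^sup>2 * (\<Sum>t<2 ^ g. (cmod (vec_index w (glue_bits n g s r t)))\<^sup>2))"
    unfolding vnorm_apply_gate_power2[OF s w] by (intro sum_mono *)
  also have "\<dots> = (\<eta> * 2 ^ g * vnorm w)\<^sup>2"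
    by (simp only: power_mult_distrib[of "\<eta> * 2 ^ g"] vnorm_power2[OF w] sum_glue_bits[OF s] sum_distrib_left)
  finally show ?thesis
    by (rule power2_le_imp_le) (use \<eta> in simp)
qed

lemma apply_gate_diff_mult_vec:
  assumes "V \<in> carrier_mat (2 ^ g) (2 ^ g)" "V' \<in> carrier_mat (2 ^ g) (2 ^ g)" "w \<in> carrier_vec (2 ^ n)"
  shows "apply_gate n g s V *\<^sub>v w - apply_gate n g s V' *\<^sub>v w = apply_gate n g s (V - V') *\<^sub>v w"
proof -
  have "selected_index g s j < 2 ^ g" for j
    by (simp add: selected_index_eq_from_bits from_bits_less)
  then have "apply_gate n g s (V - V') = apply_gate n g s V - apply_gate n g s V'"
    using assms by (intro eq_matI) (auto simp: apply_gate_def)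
  then show ?thesis
    using assms minus_mult_distrib_mat_vec[of "apply_gate n g s V" "2 ^ n" "2 ^ n" "apply_gate n g s V'" w]
    by simp
qed

section \<open>A net of circuits\<close>

text \<open>There are at most 2/\<delta> + 2 cells, and 1 \<le> 1/\<delta>.\<close>

lemma card_floor_divide_le:
  fixes \<delta> :: real
  assumes "0 < \<delta>" "\<delta> \<le> 1"
  shows "real (card {\<lfloor>- 1 / \<delta>\<rfloor>..\<lfloor>1 / \<delta>\<rfloor>}) \<le> 4 / \<delta>"
proof -
  have x: "1 \<le> 1 / \<delta>"
    using assms by simp
  have "real (card {\<lfloor>- (1 / \<delta>)\<rfloor>..\<lfloor>1 / \<delta>\<rfloor>}) = of_int \<lfloor>1 / \<delta>\<rfloor> - of_int \<lfloor>- (1 / \<delta>)\<rfloor> + 1"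
    using x by (simp, linarith)
  also have "\<dots> \<le> 4 * (1 / \<delta>)"
    using x by linarith
  finally show ?thesis
    by simp
qed

lemma abs_diff_le_if_floor_divide_eq:
  fixes \<delta> x y :: real
  assumes "0 < \<delta>" "\<lfloor>x / \<delta>\<rfloor> = \<lfloor>y / \<delta>\<rfloor>"
  shows "\<bar>x - y\<bar> \<le> \<delta>"
proof -
  have "\<bar>x / \<delta> - y / \<delta>\<bar> \<le> 1"
    using assms(2) by linarith
  then have "\<bar>x - y\<bar> / \<delta> \<le> 1"
    using assms(1) by (simp flip: diff_divide_distrib)
  then show ?thesis
    using assms(1) by (simp add: field_simps)
qed

text \<open>The centres of the net are chosen in \<open>S\<close> itself, one for each nonempty cell of the grid.\<close>

lemma matrix_net:
  fixes S :: "complex mat set" and \<delta> :: real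
  assumes S: "\<And>V i j. V \<in> S \<Longrightarrow> i < d \<Longrightarrow> j < d \<Longrightarrow> cmod (V $$ (i, j)) \<le> 1"
    and \<delta>: "0 < \<delta>" "\<delta> \<le> 1"
  obtains F where "finite F" "F \<subseteq> S" "real (card F) \<le> (4 / \<delta>) ^ (2 * d\<^sup>2)"
    "\<And>V. V \<in> S \<Longrightarrow> \<exists>V'\<in>F. \<forall>i<d. \<forall>j<d. cmod (V $$ (i, j) - V' $$ (i, j)) \<le> 2 * \<delta>"
proof -
  define B where "B = {\<lfloor>- 1 / \<delta>\<rfloor>..\<lfloor>1 / \<delta>\<rfloor>}"
  define cell where "cell V = (\<lambda>p\<in>{..<d} \<times> {..<d}. (\<lfloor>Re (V $$ p) / \<delta>\<rfloor>, \<lfloor>Im (V $$ p) / \<delta>\<rfloor>))"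
    for V :: "complex mat"
  have B: "\<lfloor>x / \<delta>\<rfloor> \<in> B" if "\<bar>x\<bar> \<le> 1" for x
  proof -
    have "- 1 / \<delta> \<le> x / \<delta>"
      using that \<delta> by (intro divide_right_mono) auto
    moreover have "x / \<delta> \<le> 1 / \<delta>"
      using that \<delta> by (intro divide_right_mono) auto
    ultimately show ?thesis
      unfolding B_def by (auto intro: floor_mono)
  qed
  have cells: "cell ` S \<subseteq> ({..<d} \<times> {..<d}) \<rightarrow>\<^sub>E (B \<times> B)"
  proof
    fix c assume "c \<in> cell ` S"
    then obtain V where V: "V \<in> S" "c = cell V"
      by auto
    have "\<lfloor>Re (V $$ p) / \<delta>\<rfloor> \<in> B \<and> \<lfloor>Im (V $$ p) / \<delta>\<rfloor> \<in> B" if "p \<in> {..<d} \<times> {..<d}" for p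
      using that S[OF V(1)] order_trans[OF abs_Re_le_cmod] order_trans[OF abs_Im_le_cmod]
      by (cases p) (auto intro!: B)
    then show "c \<in> ({..<d} \<times> {..<d}) \<rightarrow>\<^sub>E (B \<times> B)"
      by (auto simp: V(2) cell_def)
  qed
  have fin: "finite (({..<d} \<times> {..<d}) \<rightarrow>\<^sub>E (B \<times> B))"
    by (intro finite_PiE) (auto simp: B_def)
  \<comment> \<open>Representatives from \<open>S\<close> itself keep the net inside the unitary
    matrices when \<open>S\<close> is the set of these, so that products of net gates are still
    isometric.\<close>
  define F where "F = inv_into S cell ` cell ` S"
  show ?thesis
  proof
    show "finite F"
      unfolding F_def using finite_subset[OF cells fin] by simp
    show "F \<subseteq> S"
      by (auto simp: F_def intro: inv_into_into)
    have "card F \<le> card (cell ` S)"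
      unfolding F_def by (rule card_image_le) (rule finite_subset[OF cells fin])
    also have "\<dots> \<le> card (({..<d} \<times> {..<d}) \<rightarrow>\<^sub>E (B \<times> B))"
      by (rule card_mono[OF fin cells])
    \<comment> \<open>Each of the \<open>d * d\<close> complex entries has a real and an imaginary
      cell.\<close>
    also have "\<dots> = card B ^ (2 * d\<^sup>2)"
      by (subst card_funcsetE) (auto simp: card_cartesian_product power2_eq_square power_mult)
    finally have "real (card F) \<le> real (card B) ^ (2 * d\<^sup>2)"
      by (metis of_nat_le_iff of_nat_power)
    also have "\<dots> \<le> (4 / \<delta>) ^ (2 * d\<^sup>2)"
      unfolding B_def by (intro power_mono card_floor_divide_le \<delta>) auto
    finally show "real (card F) \<le> (4 / \<delta>) ^ (2 * d\<^sup>2)" .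
    fix V assume V: "V \<in> S"
    define V' where "V' = inv_into S cell (cell V)"
    have eq: "cell V' = cell V"
      unfolding V'_def using V by (intro f_inv_into_f) auto
    show "\<exists>V'\<in>F. \<forall>i<d. \<forall>j<d. cmod (V $$ (i, j) - V' $$ (i, j)) \<le> 2 * \<delta>"
    proof (intro bexI[of _ V'] allI impI)
      show "V' \<in> F"
        using V by (auto simp: F_def V'_def)
      fix i j assume "i < d" "j < d"
      then have "\<lfloor>Re (V' $$ (i, j)) / \<delta>\<rfloor> = \<lfloor>Re (V $$ (i, j)) / \<delta>\<rfloor> \<and> \<lfloor>Im (V' $$ (i, j)) / \<delta>\<rfloor> = \<lfloor>Im (V $$ (i, j)) / \<delta>\<rfloor>"
        using fun_cong[OF eq, of "(i, j)"] by (simp add: cell_def)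
      then have "\<bar>Re (V $$ (i, j) - V' $$ (i, j))\<bar> \<le> \<delta>" "\<bar>Im (V $$ (i, j) - V' $$ (i, j))\<bar> \<le> \<delta>"
        using \<delta>(1) by (auto intro!: abs_diff_le_if_floor_divide_eq)
      then show "cmod (V $$ (i, j) - V' $$ (i, j)) \<le> 2 * \<delta>"
        using cmod_le[of "V $$ (i, j) - V' $$ (i, j)"] by linarith
    qed
  qed
qed

text \<open>Allows a choice of qubits to be restricted to \<open>{..<g}\<close>, which leaves
  finitely many choices.\<close>

lemma apply_gate_cong:
  assumes "\<And>q. q < g \<Longrightarrow> s q = s' q"
  shows "apply_gate n g s V = apply_gate n g s' V"
proof -
  have "selected_index g s = selected_index g s'" "s ` {..<g} = s' ` {..<g}"
    using assms by (auto simp: selected_index_def)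
  then show ?thesis
    by (simp add: apply_gate_def cong: if_cong)
qed

text \<open>For \<open>d\<close> by \<open>d\<close> matrices and nonnegative \<eta> this says that
  the operator norm of the difference is at most \<eta>.\<close>

definition close_mats :: "nat \<Rightarrow> real \<Rightarrow> complex mat \<Rightarrow> complex mat \<Rightarrow> bool" where
  "close_mats d \<eta> U U' \<longleftrightarrow> (\<forall>w\<in>carrier_vec d. vnorm (U *\<^sub>v w - U' *\<^sub>v w) \<le> \<eta> * vnorm w)"

text \<open>There are at most \<open>n ^ g\<close> choices of qubits, each combined with a net of
  the unitary matrices. An entrywise error 2\<delta> becomes an operator error 2\<delta>
  2^g.\<close>

lemma gates_net:
  fixes \<delta> :: real
  assumes \<delta>: "0 < \<delta>" "\<delta> \<le> 1"
  obtains G where "finite G" "G \<subseteq> gates g n" "real (card G) \<le> real n ^ g * (4 / \<delta>) ^ (2 * (2 ^ g)\<^sup>2)"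
    "\<And>U. U \<in> gates g n \<Longrightarrow> \<exists>U'\<in>G. close_mats (2 ^ n) (2 * \<delta> * 2 ^ g) U U'"
proof -
  obtain F where F: "finite F" "F \<subseteq> unitary_mats (2 ^ g)" "real (card F) \<le> (4 / \<delta>) ^ (2 * (2 ^ g)\<^sup>2)"
    "\<And>V. V \<in> unitary_mats (2 ^ g) \<Longrightarrow>
      \<exists>V'\<in>F. \<forall>i<2 ^ g. \<forall>j<2 ^ g. cmod (V $$ (i, j) - V' $$ (i, j)) \<le> 2 * \<delta>"
    by (rule matrix_net[OF unitary_mats_entry_le[of _ "2 ^ g"] \<delta>]) (assumption | rule that)+
  define I where "I = {s \<in> {..<g} \<rightarrow>\<^sub>E {..<n}. inj_on s {..<g}}"
  have I: "finite I" "card I \<le> n ^ g"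
  proof -
    have fin: "finite ({..<g} \<rightarrow>\<^sub>E {..<n})"
      by (intro finite_PiE) auto
    then show "finite I"
      by (simp add: I_def)
    have "card I \<le> card ({..<g} \<rightarrow>\<^sub>E {..<n})"
      by (intro card_mono fin) (auto simp: I_def)
    then show "card I \<le> n ^ g"
      by (simp add: card_funcsetE)
  qed
  show ?thesis
  proof
    show "finite ((\<lambda>(s, V). apply_gate n g s V) ` (I \<times> F))"
      using I F by simp
    show "(\<lambda>(s, V). apply_gate n g s V) ` (I \<times> F) \<subseteq> gates g n"
      using F(2) by (fastforce simp: gates_def I_def)
    have "card ((\<lambda>(s, V). apply_gate n g s V) ` (I \<times> F)) \<le> card I * card F"
      using card_image_le[of "I \<times> F"] I F by (simp add: card_cartesian_product)
    then have "real (card ((\<lambda>(s, V). apply_gate n g s V) ` (I \<times> F))) \<le> real (card I) * real (card F)"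
      by (metis of_nat_le_iff of_nat_mult)
    also have "\<dots> \<le> real n ^ g * (4 / \<delta>) ^ (2 * (2 ^ g)\<^sup>2)"
      using I(2) F(3) by (intro mult_mono) (auto simp flip: of_nat_power)
    finally show "real (card ((\<lambda>(s, V). apply_gate n g s V) ` (I \<times> F))) \<le> real n ^ g * (4 / \<delta>) ^ (2 * (2 ^ g)\<^sup>2)" .
    fix U assume "U \<in> gates g n"
    then obtain s V where s: "s ` {..<g} \<subseteq> {..<n}" "inj_on s {..<g}" and V: "V \<in> unitary_mats (2 ^ g)"
      and U: "U = apply_gate n g s V"
      by (auto simp: gates_def)
    obtain V' where V': "V' \<in> F" "\<And>i j. i < 2 ^ g \<Longrightarrow> j < 2 ^ g \<Longrightarrow> cmod (V $$ (i, j) - V' $$ (i, j)) \<le> 2 * \<delta>"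
      using F(4)[OF V] by blast
    have carr: "V \<in> carrier_mat (2 ^ g) (2 ^ g)" "V' \<in> carrier_mat (2 ^ g) (2 ^ g)"
      using V V'(1) F(2) by (auto simp: unitary_mats_def)
    show "\<exists>U'\<in>(\<lambda>(s, V). apply_gate n g s V) ` (I \<times> F). close_mats (2 ^ n) (2 * \<delta> * 2 ^ g) U U'"
    proof (rule bexI[of _ "apply_gate n g s V'"])
      show "close_mats (2 ^ n) (2 * \<delta> * 2 ^ g) U (apply_gate n g s V')"
        unfolding close_mats_def U
        using carr V'(2) by (auto simp: apply_gate_diff_mult_vec intro!: vnorm_apply_gate_le s)
      have "restrict s {..<g} \<in> I"
        using s by (auto simp: I_def inj_on_def)
      moreover have "apply_gate n g s V' = apply_gate n g (restrict s {..<g}) V'"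
        by (rule apply_gate_cong) simp
      ultimately show "apply_gate n g s V' \<in> (\<lambda>(s, V). apply_gate n g s V) ` (I \<times> F)"
        using V'(1) by force
    qed
  qed
qed

section \<open>Accumulation of errors along a circuit\<close>

lemma isometric_gates: "U \<in> gates g n \<Longrightarrow> isometric (2 ^ n) U"
  by (auto simp: gates_def isometric_apply_gate)

lemma isometric_mult:
  assumes "isometric d U" "isometric d W"
  shows "isometric d (U * W)"
  unfolding isometric_def
proof (intro conjI ballI)
  fix w :: "complex vec" assume w: "w \<in> carrier_vec d"
  have "U * W *\<^sub>v w = U *\<^sub>v (W *\<^sub>v w)"
    using assms w by (intro assoc_mult_mat_vec) (auto simp: isometric_def)
  moreover have "W *\<^sub>v w \<in> carrier_vec d"
    using assms(2) w by (auto simp: isometric_def)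
  ultimately show "vnorm (U * W *\<^sub>v w) = vnorm w"
    using assms w by (simp add: isometric_def)
qed (use assms in \<open>auto simp: isometric_def\<close>)

lemma isometric_foldr:
  "(\<And>U. U \<in> set Us \<Longrightarrow> isometric d U) \<Longrightarrow> isometric d (foldr (*) Us (1\<^sub>m d))"
proof (induction Us)
  case Nil
  then show ?case
    by (simp add: isometric_def)
next
  case (Cons U Us)
  then show ?case
    by (simp add: isometric_mult)
qed

lemma isometric_circuits: "U \<in> circuits b g n \<Longrightarrow> isometric (2 ^ n) U"
  by (auto simp: circuits_def intro!: isometric_foldr intro: isometric_gates)

text \<open>Write UW - U'W' = U (W - W') + (U - U') W'. Here U preserves the norm of the first error
  and W' that of the vector fed into the second, so errors add without amplification.\<close>

lemma close_mats_mult: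
  assumes "isometric d U" "isometric d U'" "isometric d W" "isometric d W'"
    and close: "close_mats d \<eta> U U'" "close_mats d \<eta>' W W'"
  shows "close_mats d (\<eta> + \<eta>') (U * W) (U' * W')"
  unfolding close_mats_def
proof
  fix w :: "complex vec" assume w: "w \<in> carrier_vec d"
  have carr: "U \<in> carrier_mat d d" "U' \<in> carrier_mat d d" "W \<in> carrier_mat d d" "W' \<in> carrier_mat d d"
    using assms by (auto simp: isometric_def)
  have Ww: "W *\<^sub>v w \<in> carrier_vec d" "W' *\<^sub>v w \<in> carrier_vec d"
    using carr w by auto
  have "U * W *\<^sub>v w - U' * W' *\<^sub>v w = U *\<^sub>v (W *\<^sub>v w) - U' *\<^sub>v (W' *\<^sub>v w)"
    using carr w by (simp add: assoc_mult_mat_vec)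
  also have "\<dots> = U *\<^sub>v (W *\<^sub>v w - W' *\<^sub>v w) + (U *\<^sub>v (W' *\<^sub>v w) - U' *\<^sub>v (W' *\<^sub>v w))"
    using carr Ww by (subst mult_minus_distrib_mat_vec) auto
  also have "vnorm \<dots> \<le> vnorm (U *\<^sub>v (W *\<^sub>v w - W' *\<^sub>v w)) + vnorm (U *\<^sub>v (W' *\<^sub>v w) - U' *\<^sub>v (W' *\<^sub>v w))"
    using carr Ww by (intro vnorm_triangle[of _ d]) auto
  also have "vnorm (U *\<^sub>v (W *\<^sub>v w - W' *\<^sub>v w)) = vnorm (W *\<^sub>v w - W' *\<^sub>v w)"
    using assms(1) Ww by (auto simp: isometric_def)
  also have "\<dots> \<le> \<eta>' * vnorm w"
    using close(2) w by (auto simp: close_mats_def)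
  also have "vnorm (U *\<^sub>v (W' *\<^sub>v w) - U' *\<^sub>v (W' *\<^sub>v w)) \<le> \<eta> * vnorm (W' *\<^sub>v w)"
    using close(1) Ww by (auto simp: close_mats_def)
  also have "vnorm (W' *\<^sub>v w) = vnorm w"
    using assms(4) w by (auto simp: isometric_def)
  finally show "vnorm (U * W *\<^sub>v w - U' * W' *\<^sub>v w) \<le> (\<eta> + \<eta>') * vnorm w"
    by (simp add: algebra_simps)
qed

lemma close_mats_foldr:
  assumes "list_all2 (close_mats d \<eta>) Us Us'"
    and "\<And>U. U \<in> set Us \<union> set Us' \<Longrightarrow> isometric d U"
  shows "close_mats d (real (length Us) * \<eta>) (foldr (*) Us (1\<^sub>m d)) (foldr (*) Us' (1\<^sub>m d))"
  using assms
proof (induction rule: list_all2_induct)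
  case Nil
  show ?case
    by (simp add: close_mats_def vnorm_def L2_set_def)
next
  case (Cons U Us U' Us')
  have "close_mats d (\<eta> + real (length Us) * \<eta>) (U * foldr (*) Us (1\<^sub>m d)) (U' * foldr (*) Us' (1\<^sub>m d))"
    using Cons by (intro close_mats_mult isometric_foldr) auto
  then show ?case
    by (simp add: algebra_simps)
qed

text \<open>Bounds the number of gate lists of length at most \<open>b\<close> over a net of
  \<open>a\<close> gates.\<close>

lemma sum_power_le_power: "(\<Sum>i\<le>b. a ^ i) \<le> (a + 1 :: nat) ^ b"
proof (induction b)
  case (Suc b)
  have "(\<Sum>i\<le>Suc b. a ^ i) = (\<Sum>i\<le>b. a ^ i) + a * a ^ b"
    by simp
  also have "\<dots> \<le> (a + 1) ^ b + a * (a + 1) ^ b"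
    by (intro add_mono Suc mult_left_mono power_mono) auto
  also have "\<dots> = (a + 1) ^ Suc b"
    by simp
  finally show ?case .
qed simp

text \<open>Replace every gate of a circuit by a nearby gate of the net; at most \<open>b\<close>
  errors add up.\<close>

lemma circuits_net:
  fixes \<delta> :: real
  assumes \<delta>: "0 < \<delta>" "\<delta> \<le> 1"
  obtains C where "finite C" "C \<subseteq> circuits b g n"
    "real (card C) \<le> (real n ^ g * (4 / \<delta>) ^ (2 * (2 ^ g)\<^sup>2) + 1) ^ b"
    "\<And>U. U \<in> circuits b g n \<Longrightarrow> \<exists>U'\<in>C. close_mats (2 ^ n) (real b * (2 * \<delta> * 2 ^ g)) U U'"
proof -
  obtain G where G: "finite G" "G \<subseteq> gates g n" "real (card G) \<le> real n ^ g * (4 / \<delta>) ^ (2 * (2 ^ g)\<^sup>2)"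
    "\<And>U. U \<in> gates g n \<Longrightarrow> \<exists>U'\<in>G. close_mats (2 ^ n) (2 * \<delta> * 2 ^ g) U U'"
    using gates_net[OF \<delta>] by metis
  define L where "L = {Us. set Us \<subseteq> G \<and> length Us \<le> b}"
  have L: "finite L" "card L \<le> (card G + 1) ^ b"
    using finite_lists_length_le[OF G(1)] card_lists_length_le[OF G(1)] sum_power_le_power[of "card G" b]
    by (auto simp: L_def)
  show ?thesis
  proof
    show "finite ((\<lambda>Us. foldr (*) Us (1\<^sub>m (2 ^ n))) ` L)"
      using L by simp
    show "(\<lambda>Us. foldr (*) Us (1\<^sub>m (2 ^ n))) ` L \<subseteq> circuits b g n"
      using G(2) by (auto simp: circuits_def L_def)
    have "card ((\<lambda>Us. foldr (*) Us (1\<^sub>m (2 ^ n) :: complex mat)) ` L) \<le> (card G + 1) ^ b"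
      using card_image_le[OF L(1)] L(2) by (rule order_trans)
    then have "real (card ((\<lambda>Us. foldr (*) Us (1\<^sub>m (2 ^ n) :: complex mat)) ` L)) \<le> (real (card G) + 1) ^ b"
      by (metis of_nat_1 of_nat_add of_nat_le_iff of_nat_power)
    also have "\<dots> \<le> (real n ^ g * (4 / \<delta>) ^ (2 * (2 ^ g)\<^sup>2) + 1) ^ b"
      using G(3) by (intro power_mono) auto
    finally show "real (card ((\<lambda>Us. foldr (*) Us (1\<^sub>m (2 ^ n) :: complex mat)) ` L))
        \<le> (real n ^ g * (4 / \<delta>) ^ (2 * (2 ^ g)\<^sup>2) + 1) ^ b" .
    fix U assume "U \<in> circuits b g n"
    then obtain Us where Us: "length Us \<le> b" "set Us \<subseteq> gates g n" and U: "U = foldr (*) Us (1\<^sub>m (2 ^ n))"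
      by (auto simp: circuits_def)
    obtain f where f: "\<And>U. U \<in> gates g n \<Longrightarrow> f U \<in> G \<and> close_mats (2 ^ n) (2 * \<delta> * 2 ^ g) U (f U)"
      using G(4) by metis
    have "close_mats (2 ^ n) (real (length Us) * (2 * \<delta> * 2 ^ g)) U (foldr (*) (map f Us) (1\<^sub>m (2 ^ n)))"
      unfolding U
    proof (rule close_mats_foldr)
      show "list_all2 (close_mats (2 ^ n) (2 * \<delta> * 2 ^ g)) Us (map f Us)"
        using f Us(2) by (auto simp: list_all2_conv_all_nth subset_iff)
      show "isometric (2 ^ n) W" if "W \<in> set Us \<union> set (map f Us)" for W
        using that f Us(2) G(2) by (auto intro!: isometric_gates)
    qed
    \<comment> \<open>A circuit with fewer than \<open>b\<close> gates also satisfies the error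
      bound for \<open>b\<close> gates.\<close>
    moreover have "real (length Us) * (2 * \<delta> * 2 ^ g) * vnorm w \<le> real b * (2 * \<delta> * 2 ^ g) * vnorm w" for w
      using Us(1) \<delta> by (intro mult_right_mono) auto
    ultimately have "close_mats (2 ^ n) (real b * (2 * \<delta> * 2 ^ g)) U (foldr (*) (map f Us) (1\<^sub>m (2 ^ n)))"
      unfolding close_mats_def by (meson order_trans)
    moreover have "map f Us \<in> L"
      using f Us by (auto simp: L_def)
    ultimately show "\<exists>U'\<in>(\<lambda>Us. foldr (*) Us (1\<^sub>m (2 ^ n))) ` L. close_mats (2 ^ n) (real b * (2 * \<delta> * 2 ^ g)) U U'"
      by blast
  qed
qed

section \<open>Outputs of circuits and the union bound\<close>

text \<open>The pair of \<open>c\<close> and \<open>c'\<close> is the remainder and the quotient of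
  the index modulo \<open>2 ^ m\<close>.\<close>

lemma sum_output_bits:
  assumes "m \<le> n"
  shows "(\<Sum>c<2 ^ m. \<Sum>c'<2 ^ (n - m). f (c + 2 ^ m * c')) = (\<Sum>i<(2::nat) ^ n. f i)"
proof -
  have n: "2 ^ n = (2::nat) ^ (n - m) * 2 ^ m"
    using assms by (simp flip: power_add)
  have "bij_betw (\<lambda>(c, c'). c + 2 ^ m * c') ({..<2 ^ m} \<times> {..<2 ^ (n - m)}) {..<(2::nat) ^ n}"
  proof (rule bij_betw_byWitness[where f' = "\<lambda>i. (i mod 2 ^ m, i div 2 ^ m)"])
    show "(\<lambda>(c, c'). c + 2 ^ m * c') ` ({..<2 ^ m} \<times> {..<2 ^ (n - m)}) \<subseteq> {..<(2::nat) ^ n}"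
    proof clarify
      fix c c' :: nat assume "c < 2 ^ m" "c' < 2 ^ (n - m)"
      then have "c + 2 ^ m * c' < 2 ^ m * Suc c'"
        by simp
      also have "\<dots> \<le> 2 ^ m * 2 ^ (n - m)"
        using \<open>c' < 2 ^ (n - m)\<close> by (intro mult_left_mono) auto
      finally show "c + 2 ^ m * c' < 2 ^ n"
        by (simp add: n mult.commute)
    qed
    show "(\<lambda>i. (i mod 2 ^ m, i div 2 ^ m)) ` {..<(2::nat) ^ n} \<subseteq> {..<2 ^ m} \<times> {..<2 ^ (n - m)}"
      by (auto simp: n less_mult_imp_div_less)
  qed auto
  from sum.reindex_bij_betw[OF this, of f] show ?thesis
    by (simp add: sum.cartesian_product case_prod_unfold)
qed

text \<open>Discarding qubits does not increase the distance. For the full distributions, |u^2 -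
  v^2| = (u + v) |u - v| and Cauchy-Schwarz give the product of norms.\<close>

lemma tvd_outcome_prob_le:
  assumes m: "m \<le> n" and x: "x \<in> carrier_vec (2 ^ n)" "y \<in> carrier_vec (2 ^ n)"
  shows "tvd (2 ^ m) (outcome_prob m n x) (outcome_prob m n y) \<le> (vnorm x + vnorm y) * vnorm (x - y)"
proof -
  let ?u = "\<lambda>i. cmod (vec_index x i)" and ?v = "\<lambda>i. cmod (vec_index y i)"
  have "tvd (2 ^ m) (outcome_prob m n x) (outcome_prob m n y)
      = (\<Sum>c<2 ^ m. \<bar>\<Sum>c'<2 ^ (n - m). (?u (c + 2 ^ m * c'))\<^sup>2 - (?v (c + 2 ^ m * c'))\<^sup>2\<bar>)"
    by (simp add: tvd_def outcome_prob_def sum_subtractf)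
  also have "\<dots> \<le> (\<Sum>c<2 ^ m. \<Sum>c'<2 ^ (n - m). \<bar>(?u (c + 2 ^ m * c'))\<^sup>2 - (?v (c + 2 ^ m * c'))\<^sup>2\<bar>)"
    by (intro sum_mono sum_abs)
  also have "\<dots> = (\<Sum>i<2 ^ n. \<bar>(?u i)\<^sup>2 - (?v i)\<^sup>2\<bar>)"
    by (rule sum_output_bits[OF m])
  also have "\<dots> \<le> (\<Sum>i<2 ^ n. \<bar>?u i + ?v i\<bar> * \<bar>cmod (vec_index (x - y) i)\<bar>)"
  proof (intro sum_mono)
    fix i :: nat assume "i \<in> {..<2 ^ n}"
    have "\<bar>(?u i)\<^sup>2 - (?v i)\<^sup>2\<bar> = \<bar>?u i + ?v i\<bar> * \<bar>?u i - ?v i\<bar>"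
      by (simp add: power2_eq_square square_diff_square_factored abs_mult)
    also have "\<dots> \<le> \<bar>?u i + ?v i\<bar> * \<bar>cmod (vec_index x i - vec_index y i)\<bar>"
      by (intro mult_left_mono) (auto simp: norm_triangle_ineq3)
    finally show "\<bar>(?u i)\<^sup>2 - (?v i)\<^sup>2\<bar> \<le> \<bar>?u i + ?v i\<bar> * \<bar>cmod (vec_index (x - y) i)\<bar>"
      using x \<open>i \<in> {..<2 ^ n}\<close> by simp
  qed
  also have "\<dots> \<le> L2_set (\<lambda>i. ?u i + ?v i) {..<2 ^ n} * L2_set (\<lambda>i. cmod (vec_index (x - y) i)) {..<2 ^ n}"
    by (rule L2_set_mult_ineq)
  also have "\<dots> \<le> (vnorm x + vnorm y) * vnorm (x - y)"
    using x L2_set_triangle_ineq[of ?u ?v "{..<2 ^ n}"] unfolding vnorm_def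
    by (intro mult_mono) auto
  finally show ?thesis .
qed

lemma ket_carrier [simp]: "ket n j \<in> carrier_vec (2 ^ n)"
  by (simp add: ket_def)

lemma vnorm_ket:
  assumes "j < 2 ^ n"
  shows "vnorm (ket n j) = 1"
proof -
  have "(vnorm (ket n j))\<^sup>2 = (\<Sum>i<2 ^ n. if i = j then 1 else 0)"
    by (subst vnorm_power2[OF ket_carrier], rule sum.cong) (use assms in \<open>auto simp: ket_def\<close>)
  also have "\<dots> = 1"
    using assms by simp
  finally show ?thesis
    by (simp add: power2_eq_1_iff) (smt (verit) vnorm_nonneg)
qed

lemma isometric_mult_ket:
  assumes "isometric (2 ^ n) U" "i < 2 ^ n"
  shows "U *\<^sub>v ket n i \<in> carrier_vec (2 ^ n)" "vnorm (U *\<^sub>v ket n i) = 1"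
  using assms by (auto simp: isometric_def vnorm_ket)

lemma sum_output_tuple:
  assumes "isometric (2 ^ n) U" "m \<le> n" "i < k" "k \<le> 2 ^ n"
  shows "(\<Sum>j<2 ^ m. output_tuple m n k U i j) = 1"
proof -
  have i: "i < 2 ^ n"
    using assms by simp
  have "(\<Sum>j<2 ^ m. output_tuple m n k U i j) = (vnorm (U *\<^sub>v ket n i))\<^sup>2"
    using assms(2,3) sum_output_bits[OF assms(2), of "\<lambda>j. (cmod (vec_index (U *\<^sub>v ket n i) j))\<^sup>2"]
    by (simp add: output_tuple_def outcome_prob_def vnorm_power2[OF isometric_mult_ket(1)[OF assms(1) i]])
  then show ?thesis
    by (simp add: isometric_mult_ket(2)[OF assms(1) i])
qed

lemma output_tuple_nonneg: "i < k \<Longrightarrow> j < 2 ^ m \<Longrightarrow> 0 \<le> output_tuple m n k U i j"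
  by (simp add: output_tuple_def outcome_prob_def sum_nonneg)

lemma tvd_output_tuple_le:
  assumes U: "isometric (2 ^ n) U" "isometric (2 ^ n) U'" and UU': "close_mats (2 ^ n) \<eta> U U'"
    and m: "m \<le> n" and i: "i < k" "k \<le> 2 ^ n"
  shows "tvd (2 ^ m) (output_tuple m n k U i) (output_tuple m n k U' i) \<le> 2 * \<eta>"
proof -
  have i': "i < 2 ^ n"
    using i by (rule less_le_trans)
  note ket = isometric_mult_ket[OF U(1) i'] isometric_mult_ket[OF U(2) i']
  have "tvd (2 ^ m) (output_tuple m n k U i) (output_tuple m n k U' i)
      = tvd (2 ^ m) (outcome_prob m n (U *\<^sub>v ket n i)) (outcome_prob m n (U' *\<^sub>v ket n i))"
    using i(1) by (simp add: output_tuple_def)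
  also have "\<dots> \<le> (vnorm (U *\<^sub>v ket n i) + vnorm (U' *\<^sub>v ket n i)) * vnorm (U *\<^sub>v ket n i - U' *\<^sub>v ket n i)"
    by (rule tvd_outcome_prob_le[OF m ket(1,3)])
  also have "\<dots> = 2 * vnorm (U *\<^sub>v ket n i - U' *\<^sub>v ket n i)"
    by (simp add: ket(2,4))
  also have "vnorm (U *\<^sub>v ket n i - U' *\<^sub>v ket n i) \<le> \<eta> * vnorm (ket n i)"
    using UU' by (simp add: close_mats_def)
  also have "vnorm (ket n i) = 1"
    by (rule vnorm_ket[OF i'])
  finally show ?thesis
    by simp
qed

lemma avg_tvd_output_tuple_le:
  assumes "isometric (2 ^ n) U" "isometric (2 ^ n) U'" "close_mats (2 ^ n) \<eta> U U'"
    and "m \<le> n" "0 < k" "k \<le> 2 ^ n"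
  shows "avg_tvd (2 ^ m) k (output_tuple m n k U) (output_tuple m n k U') \<le> 2 * \<eta>"
proof -
  have "(\<Sum>i<k. tvd (2 ^ m) (output_tuple m n k U i) (output_tuple m n k U' i)) \<le> (\<Sum>i<k. 2 * \<eta>)"
    using assms by (intro sum_mono tvd_output_tuple_le) auto
  then show ?thesis
    using assms(5) by (simp add: avg_tvd_def field_simps)
qed

lemma avg_tvd_triangle: "avg_tvd N k x z \<le> avg_tvd N k x y + avg_tvd N k y z"
proof -
  have "(\<Sum>i<k. tvd N (x i) (z i)) \<le> (\<Sum>i<k. tvd N (x i) (y i) + tvd N (y i) (z i))"
    unfolding tvd_def sum.distrib[symmetric] by (intro sum_mono) linarith
  then show ?thesis
    unfolding avg_tvd_def add_divide_distrib[symmetric] sum.distrib[symmetric]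
    by (rule divide_right_mono) simp
qed

section \<open>Numerical estimates and the union bound\<close>

text \<open>With z = 2^g \<ge> g + 1, each factor 2 is absorbed by one more power of
  \<open>z\<close>; seven powers suffice.\<close>

lemma net_exponent_le:
  assumes "1 \<le> g"
  shows "1 + g + 2 * (5 + g) * (2 ^ g)\<^sup>2 \<le> (2::nat) ^ (7 * g)"
proof -
  define z :: nat where "z = 2 ^ g"
  have z: "2 \<le> z" "g + 1 \<le> z"
    using power_increasing[OF assms, of "2::nat"] by (simp_all add: z_def Suc_le_eq)
  have step: "2 * z ^ i \<le> z ^ Suc i" for i
    using z(1) by simp
  have z2: "2 * 2 \<le> z\<^sup>2" "z \<le> z\<^sup>2"
    using mult_mono[OF z(1) z(1)] z(1) by (auto simp: power2_eq_square)
  have "5 + g \<le> 4 + z"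
    using z(2) by simp
  also have "\<dots> \<le> 2 * z\<^sup>2"
    using z2 by simp
  also have "\<dots> \<le> z ^ 3"
    using step[of 2] by (simp add: numeral_3_eq_3)
  finally have "2 * (5 + g) * z\<^sup>2 \<le> 2 * z ^ 3 * z\<^sup>2"
    by (intro mult_mono) auto
  also have "\<dots> = 2 * z ^ 5"
    by (simp flip: power_add)
  also have "\<dots> \<le> z ^ 6"
    using step[of 5] by simp
  finally have "1 + g + 2 * (5 + g) * z\<^sup>2 \<le> z ^ 1 + z ^ 6"
    using z(2) by simp
  also have "z ^ 1 \<le> z ^ 6"
    using z(1) by (intro power_increasing) auto
  also have "z ^ 6 + z ^ 6 \<le> z ^ 7"
    using step[of 6] by simp
  also have "z ^ 7 = 2 ^ (7 * g)"
    by (simp add: z_def mult.commute flip: power_mult)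
  finally show ?thesis
    by (simp add: z_def)
qed

text \<open>Every base is bounded by a power of X = 2b/\<epsilon>: since \<epsilon> \<le> 2,
  \<open>X\<close> is at least \<open>b\<close>, hence at least \<open>n\<close> and 2. The mesh
  gives 4/\<delta> = 2^(4+g) X, so the count is at most a power of \<open>X\<close> whose exponent
  was estimated above.\<close>

lemma net_size_le:
  fixes \<epsilon> :: real
  assumes b: "n \<le> b" "2 \<le> n" and g: "1 \<le> g" and \<epsilon>: "0 < \<epsilon>" "\<epsilon> \<le> 2"
  shows "(real n ^ g * (4 / (\<epsilon> / (8 * real b * 2 ^ g))) ^ (2 * (2 ^ g)\<^sup>2) + 1) ^ b
    \<le> exp (2 ^ (7 * g) * real b * ln (2 * real b / \<epsilon>))"
proof -
  define X where "X = 2 * real b / \<epsilon>"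
  have "real b * \<epsilon> \<le> real b * 2"
    using \<epsilon> by (intro mult_left_mono) auto
  then have bX: "real b \<le> X"
    using \<epsilon> by (simp add: X_def field_simps)
  then have X: "2 \<le> X" "real n \<le> X"
    using b by auto
  have "4 / (\<epsilon> / (8 * real b * 2 ^ g)) = 2 ^ (4 + g) * X"
    using \<epsilon> by (simp add: X_def power_add field_simps)
  also have "\<dots> \<le> X ^ (4 + g) * X"
    using X by (intro mult_right_mono power_mono) auto
  also have "\<dots> = X ^ (5 + g)"
    by (simp add: power_add numeral_eq_Suc)
  finally have K: "4 / (\<epsilon> / (8 * real b * 2 ^ g)) \<le> X ^ (5 + g)" .
  have "real n ^ g * (4 / (\<epsilon> / (8 * real b * 2 ^ g))) ^ (2 * (2 ^ g)\<^sup>2) \<le> X ^ g * (X ^ (5 + g)) ^ (2 * (2 ^ g)\<^sup>2)"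
    using X K \<epsilon> by (intro mult_mono power_mono) auto
  also have "\<dots> = X ^ (g + 2 * (5 + g) * (2 ^ g)\<^sup>2)"
  proof -
    have "2 * (5 + g) * (2 ^ g)\<^sup>2 = (5 + g) * (2 * (2 ^ g)\<^sup>2)"
      by (simp only: mult_ac)
    then show ?thesis
      by (simp only: power_add power_mult)
  qed
  finally have "real n ^ g * (4 / (\<epsilon> / (8 * real b * 2 ^ g))) ^ (2 * (2 ^ g)\<^sup>2) + 1
      \<le> X ^ (g + 2 * (5 + g) * (2 ^ g)\<^sup>2) + X ^ (g + 2 * (5 + g) * (2 ^ g)\<^sup>2)"
    using X by (intro add_mono one_le_power) auto
  also have "\<dots> \<le> X * X ^ (g + 2 * (5 + g) * (2 ^ g)\<^sup>2)"
    using mult_right_mono[OF X(1), of "X ^ (g + 2 * (5 + g) * (2 ^ g)\<^sup>2)"] X(1) by simp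
  also have "\<dots> = X ^ (1 + g + 2 * (5 + g) * (2 ^ g)\<^sup>2)"
    by simp
  also have "\<dots> \<le> X ^ (2 ^ (7 * g))"
    using X(1) by (intro power_increasing net_exponent_le g) auto
  finally have "(real n ^ g * (4 / (\<epsilon> / (8 * real b * 2 ^ g))) ^ (2 * (2 ^ g)\<^sup>2) + 1) ^ b \<le> (X ^ (2 ^ (7 * g))) ^ b"
    using \<epsilon> by (intro power_mono) auto
  also have "\<dots> = X ^ (2 ^ (7 * g) * b)"
    by (simp add: power_mult)
  also have "\<dots> = exp (ln X) ^ (2 ^ (7 * g) * b)"
    using X by simp
  also have "\<dots> = exp (real (2 ^ (7 * g) * b) * ln X)"
    by (rule exp_of_nat_mult[symmetric])
  finally show ?thesis
    by (simp add: X_def)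
qed

text \<open>The exponent per coordinate is -\<theta>\<epsilon>/2 + 4\<theta>^2, as the terms in 2/e
  cancel. Its minimum, at \<theta> = \<epsilon>/16, is -\<epsilon>^2/64, and \<epsilon> \<le> 2
  ensures \<theta> \<le> 1/8.\<close>

lemma tuple_factor_le:
  fixes \<epsilon> :: real
  assumes m: "1 \<le> m" and \<epsilon>: "0 < \<epsilon>" "\<epsilon> \<le> 2"
  defines "N \<equiv> (2::nat) ^ m" and "\<theta> \<equiv> \<epsilon> / 16"
  shows "exp 1 * real N * exp (real N * \<theta> * (2 / exp 1 - \<epsilon> / 2)) * exp (- (2 * \<theta> / exp 1) + 4 * \<theta>\<^sup>2) ^ (N - 1)
    \<le> exp (3 * real m - 1 / 64 * \<epsilon>\<^sup>2 * 2 ^ m)"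
proof -
  define w :: real where "w = 1 / exp 1"
  have w: "0 < w" "w \<le> 1"
    by (auto simp: w_def)
  have N: "1 \<le> N" "real N = 2 ^ m"
    by (auto simp: N_def)
  have "real N \<le> exp (real m)"
  proof -
    have "(2::real) ^ m \<le> exp 1 ^ m"
      using exp_ge_add_one_self[of 1] by (intro power_mono) auto
    then show ?thesis
      by (simp add: N exp_of_nat_mult[symmetric])
  qed
  moreover have "exp (- (2 * \<theta> / exp 1) + 4 * \<theta>\<^sup>2) ^ (N - 1) = exp ((real N - 1) * (- 2 * \<theta> * w + 4 * \<theta>\<^sup>2))"
    using N(1) by (simp add: exp_of_nat_mult[symmetric] of_nat_diff w_def)
  ultimately have "exp 1 * real N * exp (real N * \<theta> * (2 / exp 1 - \<epsilon> / 2)) * exp (- (2 * \<theta> / exp 1) + 4 * \<theta>\<^sup>2) ^ (N - 1)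
      \<le> exp 1 * exp (real m) * exp (real N * \<theta> * (2 * w - \<epsilon> / 2)) * exp ((real N - 1) * (- 2 * \<theta> * w + 4 * \<theta>\<^sup>2))"
    by (simp add: w_def)
  also have "\<dots> = exp (1 + real m + real N * \<theta> * (2 * w - \<epsilon> / 2) + (real N - 1) * (- 2 * \<theta> * w + 4 * \<theta>\<^sup>2))"
    by (simp only: exp_add)
  \<comment> \<open>Having \<open>N - 1\<close> factors instead of \<open>N\<close> leaves the
    bounded term 2\<theta>w - 4\<theta>^2, which is absorbed by 3m together with the 1 because m
    \<ge> 1.\<close>
  also have "1 + real m + real N * \<theta> * (2 * w - \<epsilon> / 2) + (real N - 1) * (- 2 * \<theta> * w + 4 * \<theta>\<^sup>2)
      = 1 + real m + 2 * \<theta> * w - 4 * \<theta>\<^sup>2 - 1 / 64 * \<epsilon>\<^sup>2 * real N"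
    by (simp add: \<theta>_def power2_eq_square field_simps)
  also have "\<dots> \<le> 3 * real m - 1 / 64 * \<epsilon>\<^sup>2 * real N"
  proof -
    have "\<theta> * w \<le> 1 / 8 * 1"
      using \<epsilon> w by (intro mult_mono) (auto simp: \<theta>_def)
    moreover have "1 \<le> real m" "0 \<le> \<theta>\<^sup>2"
      using m by auto
    ultimately show ?thesis
      by linarith
  qed
  finally show ?thesis
    by (simp add: N(2))
qed

text \<open>Balls of radius 2/e - \<epsilon>/2 around the outputs of the net circuits cover the set;
  the other \<epsilon>/2 is the resolution of the net.\<close>

lemma measure_approximable_le:
  fixes \<epsilon> :: real
  assumes b: "n \<le> b" and m: "m < n" "1 \<le> m" and g: "1 \<le> g" and k: "1 \<le> k" "k \<le> 2 ^ n" and \<epsilon>: "0 < \<epsilon>" "\<epsilon> \<le> 2"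
  shows "measure (uniform_simplex_tuples (2 ^ m) k) (approximable b g m n (2 ^ m) (2 / exp 1 - \<epsilon>) k)
    \<le> exp (2 ^ (7 * g) * real b * ln (2 * real b / \<epsilon>) + 3 * real m * real k - 1 / 64 * \<epsilon>\<^sup>2 * 2 ^ m * real k)"
proof -
  let ?P = "uniform_simplex_tuples (2 ^ m) k"
  interpret P: prob_space ?P
    unfolding uniform_simplex_tuples_def by (intro prob_space_PiM prob_space_uniform_simplex)
  \<comment> \<open>Chosen so that the output error 2 b (2\<delta> 2^g) equals \<epsilon>/2.\<close>
  define \<delta> where "\<delta> = \<epsilon> / (8 * real b * 2 ^ g)"
  have b2: "2 \<le> b"
    using b m by simp
  have \<delta>: "0 < \<delta>" "\<delta> \<le> 1"
  proof -
    show "0 < \<delta>"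
      using b2 \<epsilon> by (simp add: \<delta>_def)
    have "2 * 1 \<le> 8 * real b * 2 ^ g"
      using b2 by (intro mult_mono) auto
    then show "\<delta> \<le> 1"
      using b2 \<epsilon> by (simp add: \<delta>_def divide_le_eq)
  qed
  obtain C where C: "finite C" "C \<subseteq> circuits b g n"
    "real (card C) \<le> (real n ^ g * (4 / \<delta>) ^ (2 * (2 ^ g)\<^sup>2) + 1) ^ b"
    "\<And>U. U \<in> circuits b g n \<Longrightarrow> \<exists>U'\<in>C. close_mats (2 ^ n) (real b * (2 * \<delta> * 2 ^ g)) U U'"
    using circuits_net[OF \<delta>] by metis
  define A where "A U = {x \<in> space ?P. avg_tvd (2 ^ m) k x (output_tuple m n k U) \<le> 2 / exp 1 - \<epsilon> / 2}" for U
  define B where "B = exp (3 * real m - 1 / 64 * \<epsilon>\<^sup>2 * 2 ^ m)"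
  have A: "A U \<in> sets ?P" "measure ?P (A U) \<le> B ^ k" if "U \<in> C" for U
  proof -
    have U: "isometric (2 ^ n) U"
      using that C(2) isometric_circuits by blast
    have out: "0 \<le> output_tuple m n k U i j" "(\<Sum>j<2 ^ m. output_tuple m n k U i j) = 1"
      if "i < k" "j < 2 ^ m" for i j
      using that m(1) k(2) sum_output_tuple[OF U] by (auto simp: output_tuple_nonneg)
    have Ck: "0 < (2::nat) ^ m" "0 < k" "0 \<le> \<epsilon> / 16" "\<epsilon> / 16 \<le> 1 / 8"
      using k \<epsilon> by auto
    note bound = measure_avg_tvd_le[OF Ck(1,2) out(1) out(2)[of _ 0] Ck(3,4), where d = "2 / exp 1 - \<epsilon> / 2"]
    show "A U \<in> sets ?P"
      unfolding A_def by (rule bound(1)) auto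
    have "measure ?P (A U) \<le> (exp 1 * real (2 ^ m) * exp (real (2 ^ m) * (\<epsilon> / 16) * (2 / exp 1 - \<epsilon> / 2))
        * exp (- (2 * (\<epsilon> / 16) / exp 1) + 4 * (\<epsilon> / 16)\<^sup>2) ^ (2 ^ m - 1)) ^ k"
      unfolding A_def by (rule bound(2)) auto
    also have "\<dots> \<le> B ^ k"
      unfolding B_def by (intro power_mono tuple_factor_le m \<epsilon>) auto
    finally show "measure ?P (A U) \<le> B ^ k" .
  qed
  have "approximable b g m n (2 ^ m) (2 / exp 1 - \<epsilon>) k \<subseteq> (\<Union>U\<in>C. A U)"
  proof
    fix x assume x: "x \<in> approximable b g m n (2 ^ m) (2 / exp 1 - \<epsilon>) k"
    then obtain U where U: "U \<in> circuits b g n"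
      and xU: "avg_tvd (2 ^ m) k x (output_tuple m n k U) \<le> 2 / exp 1 - \<epsilon>"
      by (auto simp: approximable_def)
    obtain U' where U': "U' \<in> C" "close_mats (2 ^ n) (real b * (2 * \<delta> * 2 ^ g)) U U'"
      using C(4)[OF U] by blast
    have "avg_tvd (2 ^ m) k (output_tuple m n k U) (output_tuple m n k U') \<le> 2 * (real b * (2 * \<delta> * 2 ^ g))"
      using U U' C(2) m(1) k by (intro avg_tvd_output_tuple_le) (auto intro: isometric_circuits)
    also have "\<dots> = \<epsilon> / 2"
      using b2 by (simp add: \<delta>_def field_simps)
    finally have "avg_tvd (2 ^ m) k x (output_tuple m n k U') \<le> 2 / exp 1 - \<epsilon> / 2"
      using xU avg_tvd_triangle[of "2 ^ m" k x "output_tuple m n k U'" "output_tuple m n k U"] by linarith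
    moreover have "x \<in> space ?P"
      using x by (fastforce simp: approximable_def uniform_simplex_tuples_def space_PiM space_uniform_simplex
          simplex_skeleton_def simplex_face_def prob_simplex_def PiE_iff)
    ultimately show "x \<in> (\<Union>U\<in>C. A U)"
      using U'(1) by (auto simp: A_def)
  qed
  then have "measure ?P (approximable b g m n (2 ^ m) (2 / exp 1 - \<epsilon>) k) \<le> measure ?P (\<Union>U\<in>C. A U)"
    using C(1) A(1) by (intro P.finite_measure_mono) auto
  also have "\<dots> \<le> (\<Sum>U\<in>C. measure ?P (A U))"
    using C(1) A(1) by (intro P.finite_measure_subadditive_finite) auto
  also have "\<dots> \<le> real (card C) * B ^ k"
    using sum_bounded_above[of C "\<lambda>U. measure ?P (A U)" "B ^ k"] A(2) by simp
  also have "\<dots> \<le> exp (2 ^ (7 * g) * real b * ln (2 * real b / \<epsilon>)) * B ^ k"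
    using order_trans[OF C(3)] net_size_le[of n b g \<epsilon>] b m g \<epsilon>
    by (intro mult_right_mono) (auto simp: \<delta>_def B_def)
  also have "\<dots> = exp (2 ^ (7 * g) * real b * ln (2 * real b / \<epsilon>) + 3 * real m * real k - 1 / 64 * \<epsilon>\<^sup>2 * 2 ^ m * real k)"
    by (simp add: B_def exp_of_nat_mult[symmetric] algebra_simps flip: exp_add)
  finally show ?thesis .
qed

theorem theorem2p1:
  shows "\<exists>c1 c2 c3 :: real. c1 > 0 \<and> c2 > 0 \<and> c3 > 0 \<and>
    (\<forall>(b::nat) (g::nat) (m::nat) (n::nat) (k::nat) (\<epsilon>::real).
       n \<le> b \<and> m < n \<and> 1 \<le> m \<and> 1 \<le> g \<and> g \<le> n \<and> 1 \<le> k \<and> k \<le> 2 ^ n \<and> 0 < \<epsilon> \<and> \<epsilon> \<le> 2 \<longrightarrow>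
       ext_ln (measure (uniform_simplex_tuples (2 ^ m) k)
                 (approximable b g m n (2 ^ m) (2 / exp 1 - \<epsilon>) k))
       \<le> ereal (2 powr (c1 * real g) * real b * ln (2 * real b / \<epsilon>)
                 + c2 * real m * real k - c3 * \<epsilon>\<^sup>2 * 2 ^ m * real k))"
proof -
  have ext_ln_le: "ext_ln x \<le> ereal y" if "0 \<le> x" "x \<le> exp y" for x y
  proof (cases "x = 0")
    case False
    then have "ln x \<le> ln (exp y)"
      using that by (subst ln_le_cancel_iff) auto
    then show ?thesis
      using False by (simp add: ext_ln_def)
  qed (simp add: ext_ln_def)
  have powr: "2 powr (7 * real g) = 2 ^ (7 * g)" for g
    using powr_realpow[of 2 "7 * g"] by simp
  show ?thesis
  \<comment> \<open>The 7 comes from \<open>net_exponent_le\<close>, the 3 and the 1/64 from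
    \<open>tuple_factor_le\<close>.\<close>
  proof (rule exI[of _ 7], rule exI[of _ 3], rule exI[of _ "1 / 64"], intro conjI allI impI)
    fix b g m n k :: nat and \<epsilon> :: real
    assume "n \<le> b \<and> m < n \<and> 1 \<le> m \<and> 1 \<le> g \<and> g \<le> n \<and> 1 \<le> k \<and> k \<le> 2 ^ n \<and> 0 < \<epsilon> \<and> \<epsilon> \<le> 2"
    then show "ext_ln (measure (uniform_simplex_tuples (2 ^ m) k)
          (approximable b g m n (2 ^ m) (2 / exp 1 - \<epsilon>) k))
        \<le> ereal (2 powr (7 * real g) * real b * ln (2 * real b / \<epsilon>)
            + 3 * real m * real k - 1 / 64 * \<epsilon>\<^sup>2 * 2 ^ m * real k)"
      unfolding powr by (intro ext_ln_le measure_nonneg measure_approximable_le) auto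
  qed simp_all
qed

end
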